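(* Let $P_{Y|X}$ be a discrete memoryless channel (DMC) with finite input alphabet $\mathcal{X}$ and finite output alphabet $\mathcal{Y}$. Fix a positive integer $M$, positive constants $\gamma_1<\gamma_2$, $a_{\mathrm{A}}$ and $a_{\mathrm{R}}$, a number $\epsilon_0\in(0,1)$, and a capacity-achieving input distribution $P_X$ (i.e. $I(P_X,P_{Y|X})=C$). Define $$(x_{\mathrm{A}},x_{\mathrm{R}})\in\arg\max_{(x,x')\in\mathcal{X}^2} D(P_{Y|X=x}\,\|\,P_{Y|X=x'}).$$ Let $(X,Y)\sim P_XP_{Y|X}$, $Y_{\mathrm{A}}\sim P_{Y|X=x_{\mathrm{A}}}$, $Y_{\mathrm{R}}\sim P_{Y|X=x_{\mathrm{R}}}$, and set $$b=b(\imath(X;Y)),\quad b_{\mathrm{A}}=b\Big(\log\frac{P_{Y|X=x_{\mathrm{A}}}(Y_{\mathrm{A}})}{P_{Y|X=x_{\mathrm{R}}}(Y_{\mathrm{A}})}\Big),\quad b_{\mathrm{R}}=b\Big(\log\frac{P_{Y|X=x_{\mathrm{R}}}(Y_{\mathrm{R}})}{P_{Y|X=x_{\mathrm{A}}}(Y_{\mathrm{R}})}\Big).$$ Define $$\epsilon'=(M-1)\big(e^{-(\gamma_1+a_{\mathrm{A}})}+e^{-\gamma_2}\big),$$ $$N'=\frac{\gamma_1+b}{C}+\big((M-1)e^{-\gamma_1}+e^{-a_{\mathrm{R}}}\big)\frac{\gamma_2-\gamma_1+b}{C}+\frac{a_{\mathrm{A}}+b_{\mathrm{A}}}{D(P_{Y|X=x_{\mathrm{A}}}\|P_{Y|X=x_{\mathrm{R}}})}+(M-1)e^{-\gamma_1}\frac{a_{\mathrm{R}}+b_{\mathrm{R}}}{D(P_{Y|X=x_{\mathrm{R}}}\|P_{Y|X=x_{\mathrm{A}}})}.$$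 Then there exists an $(N,M,\epsilon)$-VLF code for $P_{Y|X}$ with $$N\le(1-\epsilon_0)N',\qquad \epsilon\le \epsilon_0+(1-\epsilon_0)\epsilon'.$$
   Context: All logarithms are natural. The information density is $\imath(x;y)=\log\frac{P_{Y|X}(y|x)}{P_Y(y)}$, where $P_Y$ is the output distribution induced by $P_X$ and $P_{Y|X}$; $I(P_X,P_{Y|X})$ is the mutual information and $C=\max_{P_X}I(P_X,P_{Y|X})$ the capacity; $D(\cdot\|\cdot)$ is the Kullback–Leibler divergence. For a real random variable $Z$, $b(Z)\triangleq\min\big\{\frac{\mathbb{E}[(Z^+)^2]}{\mathbb{E}[Z]},\ \operatorname{ess\,sup} Z\big\}$. The DMC acts memorylessly: $P_{Y^n|X^n}(y^n|x^n)=\prod_i P_{Y|X}(y_i|x_i)$, and noiseless feedback of past outputs is available to the encoder. An $(N,M,\epsilon)$-VLF (variable-length feedback) code, for $N>0$, $M\in\mathbb{N}$, $\epsilon\in(0,1)$, consists of: (1) a common randomness random variable $U$ on a finite alphabet $\mathcal{U}$ with distribution $P_U$, revealed to transmitter and receiver before transmission; (2) encoding functions $\mathsf{f}_t:\mathcal{U}\times[M]\times\mathcal{Y}^{t-1}\to\mathcal{X}$ with $X_t=\mathsf{f}_t(U,W,Y^{t-1})$, $t\in\mathbb{N}$, where $W$ is the message, uniform on $[M]=\{1,\dots,M\}$; (3) a stopping time $\tau\in\mathbb{N}$ with respect to the filtration generated by $\{U,Y^t\}_{t\ge0}$ satisfying $\mathbb{E}[\tau]\le N$; (4) a decoding function producing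 $\hat W=\mathsf{g}_\tau(U,Y^\tau)\in[M]$ with $\Pr[\hat W\ne W]\le\epsilon$. (The code may depend on the channel $P_{Y|X}$.)
   Formalization: Assumes C > 0 and that all rows P_{Y|X=x} have the same support (equivalently, the maximal divergence is finite); otherwise b, b_A or N' contain 0/0, division by zero or ∞/∞ and are undefined. *)

theory Defs
  imports "HOL-Probability.Probability"
begin

definition joint_dist :: "('x \<Rightarrow> 'y pmf) \<Rightarrow> 'x pmf \<Rightarrow> ('x \<times> 'y) pmf" where
  "joint_dist W PX = bind_pmf PX (\<lambda>x. map_pmf (Pair x) (W x))"

definition out_dist :: "('x \<Rightarrow> 'y pmf) \<Rightarrow> 'x pmf \<Rightarrow> 'y pmf" where
  "out_dist W PX = bind_pmf PX W"

definition info_density :: "('x \<Rightarrow> 'y pmf) \<Rightarrow> 'x pmf \<Rightarrow> 'x \<Rightarrow> 'y \<Rightarrow> real" where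
  "info_density W PX x y = ln (pmf (W x) y / pmf (out_dist W PX) y)"

definition mutual_info :: "('x \<Rightarrow> 'y pmf) \<Rightarrow> 'x pmf \<Rightarrow> real" where
  "mutual_info W PX =
     measure_pmf.expectation (joint_dist W PX) (\<lambda>(x, y). info_density W PX x y)"

definition capacity :: "('x \<Rightarrow> 'y pmf) \<Rightarrow> real" where
  "capacity W = (SUP PX. mutual_info W PX)"

definition kl_div :: "'y pmf \<Rightarrow> 'y pmf \<Rightarrow> real" where
  "kl_div P Q = measure_pmf.expectation P (\<lambda>y. ln (pmf P y / pmf Q y))"

text \<open>b(Z) = min{ E[(Z^+)^2]/E[Z], ess sup Z } for the real random variable Z = f(A), A ~ p.
  For a discrete distribution the essential supremum is the maximum of f over the support.\<close>
definition bfun :: "'a pmf \<Rightarrow> ('a \<Rightarrow> real) \<Rightarrow> real" where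
  "bfun p f = min (measure_pmf.expectation p (\<lambda>a. (max 0 (f a))\<^sup>2) / measure_pmf.expectation p f)
                  (Max (f ` set_pmf p))"

text \<open>Common randomness U takes values in nat with a finitely supported distribution PU.
  Encoder: enc u w ys is the channel input X_t, where ys = Y^{t-1} (t = length ys + 1).
  Stopping rule: stop u ys says whether to stop after observing ys = Y^t (t = length ys),
  so tau = least t with stop u (Y^t); tau is a stopping time w.r.t. sigma(U, Y^t).
  Decoder: dec u ys with ys = Y^tau. Messages are {1..M}, uniform.\<close>

definition hist_prob ::
  "('x \<Rightarrow> 'y pmf) \<Rightarrow> (nat \<Rightarrow> nat \<Rightarrow> 'y list \<Rightarrow> 'x) \<Rightarrow> nat \<Rightarrow> nat \<Rightarrow> 'y list \<Rightarrow> real" where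
  "hist_prob W enc u w ys = (\<Prod>i<length ys. pmf (W (enc u w (take i ys))) (ys ! i))"

definition stops_at :: "(nat \<Rightarrow> 'y list \<Rightarrow> bool) \<Rightarrow> nat \<Rightarrow> 'y list \<Rightarrow> bool" where
  "stops_at stop u ys \<longleftrightarrow> stop u ys \<and> (\<forall>k<length ys. \<not> stop u (take k ys))"

definition prob_tau_eq ::
  "('x \<Rightarrow> 'y pmf) \<Rightarrow> nat \<Rightarrow> nat pmf \<Rightarrow> (nat \<Rightarrow> nat \<Rightarrow> 'y list \<Rightarrow> 'x)
     \<Rightarrow> (nat \<Rightarrow> 'y list \<Rightarrow> bool) \<Rightarrow> nat \<Rightarrow> real" where
  "prob_tau_eq W M PU enc stop t =
     (\<Sum>u\<in>set_pmf PU. pmf PU u * (\<Sum>w\<in>{1..M}. (1 / real M) *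
        (\<Sum>ys\<in>{ys. length ys = t}. if stops_at stop u ys then hist_prob W enc u w ys else 0)))"

definition prob_err_tau_eq ::
  "('x \<Rightarrow> 'y pmf) \<Rightarrow> nat \<Rightarrow> nat pmf \<Rightarrow> (nat \<Rightarrow> nat \<Rightarrow> 'y list \<Rightarrow> 'x)
     \<Rightarrow> (nat \<Rightarrow> 'y list \<Rightarrow> bool) \<Rightarrow> (nat \<Rightarrow> 'y list \<Rightarrow> nat) \<Rightarrow> nat \<Rightarrow> real" where
  "prob_err_tau_eq W M PU enc stop dec t =
     (\<Sum>u\<in>set_pmf PU. pmf PU u * (\<Sum>w\<in>{1..M}. (1 / real M) *
        (\<Sum>ys\<in>{ys. length ys = t}.
           if stops_at stop u ys \<and> dec u ys \<noteq> w then hist_prob W enc u w ys else 0)))"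

definition vlf_code :: "('x \<Rightarrow> 'y pmf) \<Rightarrow> real \<Rightarrow> nat \<Rightarrow> real \<Rightarrow> bool" where
  "vlf_code W N M \<epsilon> \<longleftrightarrow> 0 < N \<and> 1 \<le> M \<and> 0 < \<epsilon> \<and> \<epsilon> < 1 \<and>
     (\<exists>PU enc stop dec.
        finite (set_pmf PU) \<and>
        (\<forall>u ys. dec u ys \<in> {1..M}) \<and>
        (\<lambda>t. prob_tau_eq W M PU enc stop t) sums 1 \<and>
        summable (\<lambda>t. real t * prob_tau_eq W M PU enc stop t) \<and>
        (\<Sum>t. real t * prob_tau_eq W M PU enc stop t) \<le> N \<and>
        (\<Sum>t. prob_err_tau_eq W M PU enc stop dec t) \<le> \<epsilon>)"

end

theory Submission
  imports Defs
begin

text \<open>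
  Random coding with a confirmation phase. Every message gets i.i.d. \<open>PX\<close> letters, and the receiver tracks the
  accumulated information density of each message. The first message to reach \<open>\<gamma>1\<close> becomes a tentative
  decision, which the transmitter confirms by repeating \<open>xA\<close> or denies by repeating \<open>xR\<close> in a sequential
  probability ratio test with thresholds \<open>aA\<close> and \<open>- aR\<close>. After a rejection, communication resumes until some
  score reaches \<open>\<gamma>2\<close>. With probability \<open>\<epsilon>0\<close> the code stops at time 0 and guesses.

  Exponentiated scores of wrong messages are martingales of mean one, which bounds the error. A random walk with
  drift \<open>C\<close> and increments \<open>Z\<close> passes level \<open>t\<close> in mean time at most \<open>(t + b(Z)) / C\<close>, which is Lorden's
  bound on the overshoot. Both bounds are verified as one-step (super)harmonicity of explicit functions of the
  receiver's state, so no infinite product space is needed: the scheme is cut off at a large horizon \<open>T\<close>, which keeps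
  the common randomness finite. The cut-off costs at most \<open>N' / T\<close> in error probability, and this is paid for by
  the chance \<open>1 / M\<close> that the guess at time 0 is right.
\<close>

section \<open>Means of finitely supported distributions\<close>

text \<open>An explicit finite sum in place of the integral: linearity and exchange of means then
  need no integrability conditions.\<close>

definition fmean :: "'a pmf \<Rightarrow> ('a \<Rightarrow> real) \<Rightarrow> real" where
  "fmean p f = (\<Sum>a\<in>set_pmf p. pmf p a * f a)"

lemma fmean_eq_expectation:
  assumes "finite (set_pmf p)"
  shows "fmean p f = measure_pmf.expectation p f"
  unfolding fmean_def by (subst integral_measure_pmf[OF assms]) auto

lemma fmean_eq_sum:
  assumes "finite A" "set_pmf p \<subseteq> A"
  shows "fmean p f = (\<Sum>a\<in>A. pmf p a * f a)"
  unfolding fmean_def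
  by (rule sum.mono_neutral_left) (use assms in \<open>auto simp: set_pmf_iff\<close>)

lemma fmean_UNIV: "fmean p f = (\<Sum>a\<in>UNIV. pmf p a * f a)" for p :: "'a::finite pmf"
  by (rule fmean_eq_sum) auto

lemma fmean_cong:
  assumes "\<And>a. a \<in> set_pmf p \<Longrightarrow> f a = g a"
  shows "fmean p f = fmean p g"
  unfolding fmean_def using assms by simp

lemma fmean_mono:
  assumes "\<And>a. a \<in> set_pmf p \<Longrightarrow> f a \<le> g a"
  shows "fmean p f \<le> fmean p g"
  unfolding fmean_def using assms by (intro sum_mono mult_left_mono) auto

lemma fmean_nonneg:
  assumes "\<And>a. a \<in> set_pmf p \<Longrightarrow> 0 \<le> f a"
  shows "0 \<le> fmean p f"
  unfolding fmean_def using assms by (intro sum_nonneg mult_nonneg_nonneg) auto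

lemma fmean_const:
  assumes "finite (set_pmf p)"
  shows "fmean p (\<lambda>_. c) = c"
  using assms sum_pmf_eq_1[OF assms order_refl] by (simp add: fmean_def flip: sum_distrib_right)

lemma fmean_add: "fmean p (\<lambda>a. f a + g a) = fmean p f + fmean p g"
  by (simp add: fmean_def algebra_simps sum.distrib)

lemma fmean_diff: "fmean p (\<lambda>a. f a - g a) = fmean p f - fmean p g"
  by (simp add: fmean_def algebra_simps sum_subtractf)

lemma fmean_minus: "fmean p (\<lambda>a. - f a) = - fmean p f"
  by (simp add: fmean_def sum_negf)

lemma fmean_cmult: "fmean p (\<lambda>a. c * f a) = c * fmean p f"
  by (simp add: fmean_def sum_distrib_left mult.left_commute)

lemma fmean_cmult_right: "fmean p (\<lambda>a. f a * c) = fmean p f * c"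
  by (simp add: fmean_def sum_distrib_right mult.assoc)

lemma fmean_divide: "fmean p (\<lambda>a. f a / c) = fmean p f / c"
  by (simp add: fmean_def sum_divide_distrib)

lemma fmean_sum: "fmean p (\<lambda>a. \<Sum>i\<in>I. f i a) = (\<Sum>i\<in>I. fmean p (f i))"
  unfolding fmean_def by (simp add: sum_distrib_left) (rule sum.swap)

lemmas fmean_linear = fmean_add fmean_diff fmean_minus fmean_cmult fmean_cmult_right fmean_divide

lemma fmean_return [simp]: "fmean (return_pmf a) f = f a"
  by (simp add: fmean_def)

lemma fmean_map:
  assumes "finite (set_pmf p)"
  shows "fmean (map_pmf g p) f = fmean p (\<lambda>a. f (g a))"
  using assms by (simp add: fmean_eq_expectation)

lemma fmean_bind:
  assumes "finite (set_pmf p)" "\<And>a. a \<in> set_pmf p \<Longrightarrow> finite (set_pmf (q a))"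
  shows "fmean (bind_pmf p q) f = fmean p (\<lambda>a. fmean (q a) f)"
proof -
  have "fmean (bind_pmf p q) f = measure_pmf.expectation (bind_pmf p q) f"
    using assms by (intro fmean_eq_expectation) auto
  also have "\<dots> = (\<Sum>a\<in>set_pmf p. pmf p a *\<^sub>R measure_pmf.expectation (q a) f)"
    by (rule pmf_expectation_bind) (use assms in auto)
  also have "\<dots> = fmean p (\<lambda>a. fmean (q a) f)"
    using assms by (simp add: fmean_def[of p] fmean_eq_expectation)
  finally show ?thesis .
qed

section \<open>Mean crossing times of random walks with positive drift\<close>

text \<open>Mean number of steps to climb the remaining distance \<open>t\<close>, truncated at
  \<open>k\<close> steps. The recursion conditions on the first increment.\<close>

primrec capped_time :: "'a pmf \<Rightarrow> ('a \<Rightarrow> real) \<Rightarrow> nat \<Rightarrow> real \<Rightarrow> real" where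
  "capped_time p f 0 t = 0"
| "capped_time p f (Suc k) t = (if t \<le> 0 then 0 else 1 + fmean p (\<lambda>a. capped_time p f k (t - f a)))"

definition crossing_time :: "'a pmf \<Rightarrow> ('a \<Rightarrow> real) \<Rightarrow> real \<Rightarrow> real" where
  "crossing_time p f t = (SUP k. capped_time p f k t)"

locale drift_walk =
  fixes p :: "'a pmf" and f :: "'a \<Rightarrow> real"
  assumes finite_supp: "finite (set_pmf p)"
    and drift_pos: "0 < fmean p f"
begin

abbreviation C where "C \<equiv> fmean p f"
abbreviation z where "z \<equiv> Max (f ` set_pmf p)"
abbreviation G where "G \<equiv> crossing_time p f"

lemma le_z: "a \<in> set_pmf p \<Longrightarrow> f a \<le> z"
  using finite_supp by simp

lemma C_le_z: "C \<le> z"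
proof -
  have "C \<le> fmean p (\<lambda>_. z)" by (rule fmean_mono) (rule le_z)
  thus ?thesis by (simp add: fmean_const finite_supp)
qed

lemma z_pos: "0 < z"
  using C_le_z drift_pos by simp

lemma capped_time_nonneg: "0 \<le> capped_time p f k t"
  by (induction k arbitrary: t) (auto intro!: fmean_nonneg add_nonneg_nonneg)

lemma capped_time_Suc_ge: "capped_time p f k t \<le> capped_time p f (Suc k) t"
proof (induction k arbitrary: t)
  case 0
  show ?case using capped_time_nonneg[of "Suc 0" t] by simp
next
  case (Suc k)
  show ?case
    by (subst (1 2) capped_time.simps(2)) (auto intro!: fmean_mono Suc simp del: capped_time.simps)
qed

lemma capped_time_mono: "s \<le> t \<Longrightarrow> capped_time p f k s \<le> capped_time p f k t"
proof (induction k arbitrary: s t)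
  case (Suc k)
  have "fmean p (\<lambda>a. capped_time p f k (s - f a)) \<le> fmean p (\<lambda>a. capped_time p f k (t - f a))"
    by (rule fmean_mono) (use Suc in auto)
  moreover have "0 \<le> fmean p (\<lambda>a. capped_time p f k (t - f a))"
    by (rule fmean_nonneg) (rule capped_time_nonneg)
  ultimately show ?case using Suc.prems by auto
qed simp

text \<open>The potential \<open>(t + z) / C\<close> loses exactly 1 per step in mean. One step from
  a positive \<open>t\<close> leads no lower than \<open>- z\<close>, so the hypothesis persists
  along the walk.\<close>

lemma capped_time_le: "0 \<le> t + z \<Longrightarrow> capped_time p f k t \<le> (t + z) / C"
proof (induction k arbitrary: t)
  case 0
  thus ?case using drift_pos by simp
next
  case (Suc k)
  show ?case
  proof (cases "t \<le> 0")
    case True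
    thus ?thesis using Suc.prems drift_pos by simp
  next
    case False
    have "fmean p (\<lambda>a. capped_time p f k (t - f a)) \<le> fmean p (\<lambda>a. (t - f a + z) / C)"
      by (rule fmean_mono, rule Suc.IH) (use False le_z in fastforce)
    also have "\<dots> = (t - C + z) / C"
      by (simp add: fmean_linear fmean_const finite_supp)
    finally show ?thesis using False drift_pos by (simp add: field_simps)
  qed
qed

text \<open>A climb of \<open>t + s\<close> is a climb of \<open>t\<close> followed by one of at
  most \<open>s\<close>; the overshoot over the first level only shortens the second leg.\<close>

lemma capped_time_subadditive: "0 \<le> s \<Longrightarrow> capped_time p f k (t + s) \<le> capped_time p f k t + capped_time p f k s"
proof (induction k arbitrary: t)
  case (Suc k)
  show ?case
  proof (cases "t \<le> 0")
    case True
    have "capped_time p f (Suc k) (t + s) \<le> capped_time p f (Suc k) s"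
      by (rule capped_time_mono) (use True in auto)
    thus ?thesis using True by simp
  next
    case False
    have "fmean p (\<lambda>a. capped_time p f k (t + s - f a)) \<le> fmean p (\<lambda>a. capped_time p f k (t - f a) + capped_time p f k s)"
      by (rule fmean_mono) (use Suc.IH[OF Suc.prems, of "t - f _"] in \<open>simp add: algebra_simps\<close>)
    also have "\<dots> = fmean p (\<lambda>a. capped_time p f k (t - f a)) + capped_time p f k s"
      by (simp add: fmean_linear fmean_const finite_supp)
    finally have "capped_time p f (Suc k) (t + s) \<le> capped_time p f (Suc k) t + capped_time p f k s"
      using False Suc.prems by simp
    thus ?thesis using capped_time_Suc_ge[of k s] by linarith
  qed
qed simp

lemma capped_time_nonpos: "t \<le> 0 \<Longrightarrow> capped_time p f k t = 0"
  by (cases k) auto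

lemma capped_time_tendsto: "(\<lambda>k. capped_time p f k t) \<longlonglongrightarrow> G t"
proof -
  have "capped_time p f k t \<le> (max t 0 + z) / C" for k
    using capped_time_mono[of t "max t 0" k] capped_time_le[of "max t 0" k] z_pos by simp
  hence "bdd_above (range (\<lambda>k. capped_time p f k t))" by (intro bdd_aboveI2)
  moreover have "incseq (\<lambda>k. capped_time p f k t)"
    by (rule incseq_SucI) (rule capped_time_Suc_ge)
  ultimately show ?thesis unfolding crossing_time_def by (rule LIMSEQ_incseq_SUP)
qed

lemma G_nonneg: "0 \<le> G t"
  by (rule LIMSEQ_le_const[OF capped_time_tendsto]) (auto simp: capped_time_nonneg)

lemma G_mono: "s \<le> t \<Longrightarrow> G s \<le> G t"
  by (rule LIMSEQ_le[OF capped_time_tendsto capped_time_tendsto]) (auto intro: capped_time_mono)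

lemma G_nonpos: "t \<le> 0 \<Longrightarrow> G t = 0"
  using capped_time_tendsto[of t] by (simp add: capped_time_nonpos LIMSEQ_const_iff)

lemma G_le_z: "0 \<le> t + z \<Longrightarrow> G t \<le> (t + z) / C"
  by (rule LIMSEQ_le_const2[OF capped_time_tendsto]) (auto intro: capped_time_le)

lemma G_subadditive: "0 \<le> s \<Longrightarrow> G (t + s) \<le> G t + G s"
  by (rule LIMSEQ_le[OF capped_time_tendsto tendsto_add[OF capped_time_tendsto capped_time_tendsto]])
     (auto intro: capped_time_subadditive)

text \<open>The renewal equation: the recursion of \<open>capped_time\<close> survives the limit
  because the mean is a finite sum.\<close>

lemma G_eq:
  assumes "0 < t"
  shows "G t = 1 + fmean p (\<lambda>a. G (t - f a))"
proof (rule LIMSEQ_unique)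
  show "(\<lambda>k. capped_time p f (Suc k) t) \<longlonglongrightarrow> G t"
    by (rule LIMSEQ_Suc) (rule capped_time_tendsto)
  show "(\<lambda>k. capped_time p f (Suc k) t) \<longlonglongrightarrow> 1 + fmean p (\<lambda>a. G (t - f a))"
    using assms unfolding fmean_def capped_time.simps
    by (auto intro!: tendsto_intros capped_time_tendsto)
qed

text \<open>Adding a small multiple of \<open>\<psi>\<close>, which outgrows the allowed linear decrease and loses at least 1 per
  step in mean, makes the infimum finite; a negative infimum would then strictly exceed itself.\<close>

lemma minimum_principle:
  assumes super: "\<And>t. 0 < t \<Longrightarrow> fmean p (\<lambda>a. h (t - f a)) \<le> h t"
    and bnd: "\<And>t. t \<le> 0 \<Longrightarrow> 0 \<le> h t"
    and low: "\<And>t. 0 < t \<Longrightarrow> - c * (1 + t) \<le> h t"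
  shows "0 \<le> h t"
proof -
  define K where "K = fmean p (\<lambda>a. (f a)\<^sup>2)"
  \<comment> \<open>One step adds at most \<open>K\<close> to the mean of \<open>t\<^sup>2\<close>,
    while \<open>(K + 1) * G\<close> loses \<open>K + 1\<close>; a net loss of 1 remains.\<close>
  define \<psi> where "\<psi> t = t\<^sup>2 + (K + 1) * G t" for t
  have K: "0 \<le> K" unfolding K_def by (rule fmean_nonneg) auto
  have \<psi>_ge: "t\<^sup>2 \<le> \<psi> t" for t using K G_nonneg[of t] by (simp add: \<psi>_def)
  have \<psi>_step: "fmean p (\<lambda>a. \<psi> (t - f a)) \<le> \<psi> t - 1" if t: "0 < t" for t
  proof -
    have "fmean p (\<lambda>a. \<psi> (t - f a)) = fmean p (\<lambda>a. t\<^sup>2 - (2 * t) * f a + (f a)\<^sup>2 + (K + 1) * G (t - f a))"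
      by (rule fmean_cong) (simp add: \<psi>_def power2_eq_square algebra_simps)
    also have "\<dots> = t\<^sup>2 - 2 * t * C + K + (K + 1) * (G t - 1)"
      by (simp add: fmean_linear fmean_const finite_supp K_def G_eq[OF t])
    also have "\<dots> \<le> \<psi> t - 1" using t drift_pos by (simp add: \<psi>_def algebra_simps)
    finally show ?thesis .
  qed
  have pos: "0 \<le> h t + \<delta> * \<psi> t" if \<delta>: "0 < \<delta>" for \<delta> t
  proof (rule ccontr)
    define g where "g t = h t + \<delta> * \<psi> t" for t
    assume "\<not> 0 \<le> h t + \<delta> * \<psi> t"
    hence neg: "g t < 0" by (simp add: g_def)
    have g_bnd: "0 \<le> g s" if "s \<le> 0" for s
      using bnd[OF that] \<psi>_ge[of s] zero_le_power2[of s] \<delta> unfolding g_def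
      by (meson add_nonneg_nonneg less_imp_le mult_nonneg_nonneg order_trans)
    \<comment> \<open>Completing the square: the quadratic growth of \<open>\<psi>\<close> beats the
      linear decrease allowed for \<open>h\<close>.\<close>
    have lower: "- \<bar>c\<bar> - c\<^sup>2 / (4 * \<delta>) \<le> g s" for s
    proof (cases "s \<le> 0")
      case True
      have "0 \<le> c\<^sup>2 / (4 * \<delta>)" using \<delta> by simp
      thus ?thesis using g_bnd[OF True] by linarith
    next
      case False
      have "0 \<le> \<delta> * (s - c / (2 * \<delta>))\<^sup>2" using \<delta> by simp
      also have "\<dots> = \<delta> * s\<^sup>2 - c * s + c\<^sup>2 / (4 * \<delta>)"
        using \<delta> by (simp add: power2_eq_square field_simps)
      finally have "- \<bar>c\<bar> - c\<^sup>2 / (4 * \<delta>) \<le> - c * (1 + s) + \<delta> * s\<^sup>2"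
        by (simp add: algebra_simps)
      also have "\<dots> \<le> g s" unfolding g_def
        using low[of s] False \<psi>_ge[of s] \<delta> by (intro add_mono mult_left_mono) auto
      finally show ?thesis .
    qed
    hence bdd: "bdd_below (range g)" by (intro bdd_belowI2)
    define m where "m = (INF s. g s)"
    have m_le: "m \<le> g s" for s unfolding m_def by (rule cINF_lower[OF bdd]) simp
    have m_neg: "m < 0" using m_le[of t] neg by simp
    \<comment> \<open>On \<open>s > 0\<close> the value \<open>g s\<close> exceeds its mean after
      one step, hence \<open>m\<close>, by at least \<open>\<delta>\<close>; elsewhere it is
      nonnegative. So the infimum cannot be negative.\<close>
    have "min (m + \<delta>) 0 \<le> g s" for s
    proof (cases "s \<le> 0")
      case True
      thus ?thesis using g_bnd by (simp add: min.coboundedI2)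
    next
      case False
      have "m = fmean p (\<lambda>_. m)" by (simp add: fmean_const finite_supp)
      also have "\<dots> \<le> fmean p (\<lambda>a. g (s - f a))" by (rule fmean_mono) (rule m_le)
      also have "\<dots> = fmean p (\<lambda>a. h (s - f a)) + \<delta> * fmean p (\<lambda>a. \<psi> (s - f a))"
        by (simp add: g_def fmean_linear)
      also have "\<dots> \<le> h s + \<delta> * (\<psi> s - 1)"
        using super[of s] \<psi>_step[of s] False \<delta> by (intro add_mono mult_left_mono) auto
      finally show ?thesis by (simp add: g_def algebra_simps)
    qed
    hence "min (m + \<delta>) 0 \<le> m" unfolding m_def by (intro cINF_greatest) auto
    thus False using m_neg \<delta> by auto
  qed
  have "((\<lambda>\<delta>. h t + \<delta> * \<psi> t) \<longlongrightarrow> h t + 0 * \<psi> t) (at_right 0)"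
    by (intro tendsto_intros)
  moreover have "eventually (\<lambda>\<delta>. 0 \<le> h t + \<delta> * \<psi> t) (at_right 0)"
    using pos by (auto simp: eventually_at_filter)
  ultimately show ?thesis
    using tendsto_lowerbound[of "\<lambda>\<delta>. h t + \<delta> * \<psi> t" "h t + 0 * \<psi> t" "at_right 0" 0] by simp
qed

text \<open>Wald's identity with a nonnegative overshoot: \<open>G t - t / C\<close> is harmonic for
  \<open>t > 0\<close> and nonnegative for \<open>t \<le> 0\<close>.\<close>

lemma G_ge: "t / C \<le> G t"
proof -
  have "0 \<le> G t - t / C"
  proof (rule minimum_principle[where c = "1 / C" and h = "\<lambda>t. G t - t / C"])
    fix t :: real assume t: "0 < t"
    have "fmean p (\<lambda>a. G (t - f a) - (t - f a) / C) = G t - 1 - (t - C) / C"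
      by (simp add: fmean_linear fmean_const finite_supp G_eq[OF t])
    also have "\<dots> = G t - t / C" using drift_pos by (simp add: field_simps)
    finally show "fmean p (\<lambda>a. G (t - f a) - (t - f a) / C) \<le> G t - t / C" by simp
    have "- (1 / C) * (1 + t) \<le> - t / C" using drift_pos by (simp add: field_simps)
    thus "- (1 / C) * (1 + t) \<le> G t - t / C" using G_nonneg[of t] by simp
  next
    fix t :: real assume "t \<le> 0"
    thus "0 \<le> G t - t / C" using drift_pos G_nonneg[of t] divide_nonpos_pos[of t C] by linarith
  qed
  thus ?thesis by simp
qed

text \<open>Lorden's method: subadditivity gives \<open>t * G t \<le> 2 * H t\<close>, so a bound on the integral \<open>H\<close> of \<open>G\<close>
  controls \<open>G\<close> itself.\<close>

definition H :: "real \<Rightarrow> real" where "H t = integral {0..t} G"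

lemma G_integrable: "G integrable_on {s..t}"
  by (rule integrable_on_mono_on) (auto simp: mono_on_def intro: G_mono)

lemma H_nonpos: "t \<le> 0 \<Longrightarrow> H t = 0"
  unfolding H_def by (cases "t = 0") auto

text \<open>As \<open>G\<close> vanishes on the negative half-line, \<open>H\<close> is an
  indefinite integral of \<open>G\<close> on the whole line, also across 0.\<close>

lemma integral_G: "s \<le> t \<Longrightarrow> integral {s..t} G = H t - H s"
proof (cases "s \<le> 0")
  case s: True
  assume st: "s \<le> t"
  have zero: "integral {s..u} G = 0" if "u \<le> 0" for u
    using that by (subst integral_cong[of _ _ "\<lambda>_. 0"]) (auto simp: G_nonpos)
  show ?thesis
  proof (cases "t \<le> 0")
    case True
    thus ?thesis using zero s by (simp add: H_nonpos)
  next
    case False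
    have "integral {s..0} G + integral {0..t} G = integral {s..t} G"
      by (rule Henstock_Kurzweil_Integration.integral_combine) (use False s G_integrable in auto)
    thus ?thesis using zero[of 0] s by (simp add: H_nonpos) (simp add: H_def)
  qed
next
  case False
  assume "s \<le> t"
  hence "integral {0..s} G + integral {s..t} G = integral {0..t} G"
    by (intro Henstock_Kurzweil_Integration.integral_combine) (use False G_integrable in auto)
  thus ?thesis by (simp add: H_def)
qed

lemma has_integral_G_shift:
  assumes "0 \<le> t"
  shows "((\<lambda>s. G (s - v)) has_integral (H (t - v) - H (- v))) {0..t}"
proof -
  have "(G has_integral (H (t - v) - H (- v))) {- v..t - v}"
    using integral_G[of "- v" "t - v"] assms integrable_integral[OF G_integrable, of "- v" "t - v"] by simp
  from has_integral_affinity'[OF this[folded box_real], of 1 "- v"]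
  show ?thesis by (simp add: algebra_simps)
qed

text \<open>The renewal equation integrated over \<open>{0..t}\<close>. Shifting by an increment
  moves the lower end to \<open>- f a\<close>, and only negative increments make
  \<open>H (- f a)\<close> nonzero.\<close>

lemma H_eq:
  assumes t: "0 < t"
  shows "H t = t + fmean p (\<lambda>a. H (t - f a)) - fmean p (\<lambda>a. H (- f a))"
proof -
  have "((\<lambda>s. 1 + fmean p (\<lambda>a. G (s - f a))) has_integral
      (t - 0) * 1 + fmean p (\<lambda>a. H (t - f a) - H (- f a))) {0..t}"
    unfolding fmean_def
    using t has_integral_const_real[of "1::real" 0 t] finite_supp
    by (intro has_integral_add has_integral_sum has_integral_mult_right has_integral_G_shift) auto
  \<comment> \<open>The renewal equation is available for positive arguments; the single point 0
    does not affect the integral.\<close>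
  hence "(G has_integral t + fmean p (\<lambda>a. H (t - f a) - H (- f a))) {0..t}"
    using has_integral_spike_finite[of "{0}" "{0..t}" G "\<lambda>s. 1 + fmean p (\<lambda>a. G (s - f a))"]
    by (simp add: G_eq)
  thus ?thesis unfolding H_def[of t] by (simp add: integral_unique fmean_linear)
qed

lemma has_integral_G: "0 \<le> t \<Longrightarrow> (G has_integral H t) {0..t}"
  unfolding H_def by (rule integrable_integral) (rule G_integrable)

lemma has_integral_affine:
  assumes "0 \<le> (t::real)"
  shows "((\<lambda>s. (s + c) / C) has_integral (t\<^sup>2 / 2 + c * t) / C) {0..t}"
proof -
  have "((\<lambda>s. (s + c) / C) has_integral (t\<^sup>2 / 2 + c * t) / C - (0\<^sup>2 / 2 + c * 0) / C) {0..t}"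
    by (rule fundamental_theorem_of_calculus[OF assms])
       (use drift_pos in \<open>auto intro!: derivative_eq_intros simp flip: has_real_derivative_iff_has_vector_derivative\<close>)
  thus ?thesis by simp
qed

lemma H_ge: "0 \<le> t \<Longrightarrow> t\<^sup>2 \<le> 2 * C * H t"
proof -
  assume t: "0 \<le> t"
  have "(t\<^sup>2 / 2 + 0 * t) / C \<le> H t"
    by (rule has_integral_le[OF has_integral_affine[OF t] has_integral_G[OF t]]) (simp only: add_0_right G_ge)
  thus ?thesis using drift_pos by (simp add: field_simps)
qed

lemma H_le: "0 \<le> t \<Longrightarrow> 2 * C * H t \<le> t\<^sup>2 + 2 * z * t"
proof -
  assume t: "0 \<le> t"
  have "H t \<le> (t\<^sup>2 / 2 + z * t) / C"
    by (rule has_integral_le[OF has_integral_G[OF t] has_integral_affine[OF t]])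
       (use G_le_z z_pos in auto)
  thus ?thesis using drift_pos by (simp add: field_simps)
qed

text \<open>Integrate \<open>G t \<le> G s + G (t - s)\<close> over \<open>s\<close> in
  \<open>{0..t}\<close>; by reflection both terms on the right have integral
  \<open>H t\<close>.\<close>

lemma mult_G_le_H:
  assumes t: "0 \<le> t"
  shows "t * G t \<le> 2 * H t"
proof -
  have "((\<lambda>s. G (t - s)) has_integral H t) {0..t}"
  proof -
    have "(\<lambda>s. t - s) ` {0..t} = {0..t}"
      by (auto simp: image_iff intro: bexI[of _ "t - _"])
    thus ?thesis
      using has_integral_affinity[of G "H t" 0 t "-1" t] has_integral_G[OF t] by simp
  qed
  hence "((\<lambda>s. G s + G (t - s)) has_integral H t + H t) {0..t}"
    by (intro has_integral_add has_integral_G[OF t])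
  moreover have "((\<lambda>s. G t) has_integral t * G t) {0..t}"
    using has_integral_const_real[of "G t" 0 t] t by simp
  ultimately have "t * G t \<le> H t + H t"
    by (intro has_integral_le[of "\<lambda>s. G t" "t * G t" "{0..t}" "\<lambda>s. G s + G (t - s)"])
       (auto intro: order_trans[OF _ G_subadditive])
  thus ?thesis by simp
qed

text \<open>The right-hand side minus the left-hand side is superharmonic on \<open>t > 0\<close> and equals \<open>(t + \<rho>)\<^sup>2\<close> for
  \<open>t \<le> 0\<close>. In terms of the overshoot \<open>R\<close> this is \<open>E R\<^sup>2 \<ge> 2 \<rho> E R - \<rho>\<^sup>2\<close> with the mean
  overshoot \<open>E R = C * G t - t\<close>; the optimal \<open>\<rho>\<close> is that mean.\<close>

lemma H_quadratic_bound:
  fixes \<rho> t :: real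
  defines "K \<equiv> fmean p (\<lambda>a. (max 0 (f a))\<^sup>2)"
  shows "2 * C * H t \<le> t\<^sup>2 + K * G t - 2 * \<rho> * (C * G t - t) + \<rho>\<^sup>2"
proof -
  have K: "0 \<le> K" unfolding K_def by (rule fmean_nonneg) auto
  have "0 \<le> t\<^sup>2 + K * G t - 2 * \<rho> * (C * G t - t) + \<rho>\<^sup>2 - 2 * C * H t"
  proof (rule minimum_principle[where c = "2 * \<bar>\<rho>\<bar> * z + 2 * z" and
      h = "\<lambda>t. t\<^sup>2 + K * G t - 2 * \<rho> * (C * G t - t) + \<rho>\<^sup>2 - 2 * C * H t"])
    fix t :: real assume t: "0 < t"
    define E where "E = fmean p (\<lambda>a. (f a)\<^sup>2)"
    define N where "N = fmean p (\<lambda>a. (max 0 (- f a))\<^sup>2)"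
    have EKN: "E = K + N" unfolding E_def K_def N_def fmean_add[symmetric]
      by (rule fmean_cong) (auto simp: max_def)
    \<comment> \<open>Negative increments contribute to \<open>N\<close> and to the mean of
      \<open>H (- f a)\<close> alike, and \<open>H_ge\<close> compares the two pointwise.\<close>
    have N_le: "N \<le> 2 * C * fmean p (\<lambda>a. H (- f a))"
    proof -
      have "N \<le> fmean p (\<lambda>a. (2 * C) * H (- f a))"
        unfolding N_def by (rule fmean_mono) (auto simp: max_def H_nonpos intro!: H_ge[of "- f _", simplified])
      thus ?thesis by (simp only: fmean_cmult)
    qed
    have "fmean p (\<lambda>a. (t - f a)\<^sup>2 + K * G (t - f a) - 2 * \<rho> * (C * G (t - f a) - (t - f a)) + \<rho>\<^sup>2 - 2 * C * H (t - f a))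
      = fmean p (\<lambda>a. t\<^sup>2 - (2 * t) * f a + (f a)\<^sup>2 + K * G (t - f a)
          - 2 * \<rho> * (C * G (t - f a) - (t - f a)) + \<rho>\<^sup>2 - 2 * C * H (t - f a))"
      by (rule fmean_cong) (simp add: power2_eq_square algebra_simps)
    also have "\<dots> = t\<^sup>2 - 2 * t * C + E + K * (G t - 1) - 2 * \<rho> * (C * (G t - 1) - (t - C))
        + \<rho>\<^sup>2 - 2 * C * (H t - t + fmean p (\<lambda>a. H (- f a)))"
      by (simp add: fmean_linear fmean_const finite_supp E_def G_eq[OF t] H_eq[OF t])
    \<comment> \<open>All terms cancel except \<open>E - K\<close>, which is \<open>N\<close>, and
      the mean of \<open>H (- f a)\<close> times \<open>- 2 * C\<close>.\<close>
    also have "\<dots> \<le> t\<^sup>2 + K * G t - 2 * \<rho> * (C * G t - t) + \<rho>\<^sup>2 - 2 * C * H t"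
      using N_le EKN by (simp add: algebra_simps)
    finally show "fmean p (\<lambda>a. (t - f a)\<^sup>2 + K * G (t - f a) - 2 * \<rho> * (C * G (t - f a) - (t - f a)) + \<rho>\<^sup>2 - 2 * C * H (t - f a))
      \<le> t\<^sup>2 + K * G t - 2 * \<rho> * (C * G t - t) + \<rho>\<^sup>2 - 2 * C * H t" .
    \<comment> \<open>The mean overshoot lies between 0 and \<open>z\<close>. Together with
      \<open>H_le\<close>, where \<open>t\<^sup>2\<close> cancels, this gives the linear lower bound
      that the minimum principle asks for.\<close>
    have "0 \<le> C * G t - t" "C * G t - t \<le> z"
      using G_ge[of t] G_le_z[of t] t z_pos drift_pos by (auto simp: field_simps)
    hence "\<rho> * (C * G t - t) \<le> \<bar>\<rho>\<bar> * z" by (intro mult_mono) auto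
    hence "2 * \<rho> * (C * G t - t) \<le> 2 * \<bar>\<rho>\<bar> * z" by simp
    moreover have "0 \<le> K * G t" using K G_nonneg by simp
    moreover have "- (2 * \<bar>\<rho>\<bar> * z + 2 * z) * (1 + t) = - 2 * \<bar>\<rho>\<bar> * z - 2 * z - 2 * (\<bar>\<rho>\<bar> * z * t) - 2 * z * t"
      by (simp add: algebra_simps)
    moreover have "0 \<le> \<bar>\<rho>\<bar> * z * t" using t z_pos by simp
    ultimately show "- (2 * \<bar>\<rho>\<bar> * z + 2 * z) * (1 + t)
        \<le> t\<^sup>2 + K * G t - 2 * \<rho> * (C * G t - t) + \<rho>\<^sup>2 - 2 * C * H t"
      using H_le[of t] t z_pos zero_le_power2[of \<rho>] by linarith
  next
    fix t :: real assume t: "t \<le> 0"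
    have "0 \<le> (t + \<rho>)\<^sup>2" by simp
    thus "0 \<le> t\<^sup>2 + K * G t - 2 * \<rho> * (C * G t - t) + \<rho>\<^sup>2 - 2 * C * H t"
      using t by (simp add: G_nonpos H_nonpos power2_eq_square algebra_simps)
  qed
  thus ?thesis by simp
qed

text \<open>Chaining \<open>mult_G_le_H\<close> with the quadratic bound at
  \<open>\<rho> = C * g - t\<close> makes \<open>t\<^sup>2\<close> cancel; every remaining term
  carries a factor \<open>g\<close>, and division by it leaves a linear bound on
  \<open>g\<close>.\<close>

lemma G_le_second_moment:
  assumes t: "0 < t"
  shows "G t \<le> (t + fmean p (\<lambda>a. (max 0 (f a))\<^sup>2) / C) / C"
proof -
  define K where "K = fmean p (\<lambda>a. (max 0 (f a))\<^sup>2)"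
  define g where "g = G t"
  have g: "0 < g" using G_ge[of t] t drift_pos unfolding g_def by (smt (verit) divide_pos_pos)
  have "C * (t * g) \<le> C * (2 * H t)"
    using mult_G_le_H[of t] t drift_pos unfolding g_def by (intro mult_left_mono) auto
  also have "\<dots> \<le> t\<^sup>2 + K * g - 2 * (C * g - t) * (C * g - t) + (C * g - t)\<^sup>2"
    using H_quadratic_bound[of t "C * g - t"] by (simp add: K_def g_def)
  finally have "(C * C * g) * g \<le> (K + C * t) * g"
    by (simp add: power2_eq_square algebra_simps)
  hence "C * C * g \<le> K + C * t" using g by simp
  thus ?thesis using drift_pos unfolding K_def[symmetric] g_def[symmetric]
    by (simp add: field_simps)
qed

text \<open>The two entries of the minimum in \<open>bfun\<close> are the two overshoot bounds, by
  the second moment and by the largest increment.\<close>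

lemma crossing_time_le:
  assumes t: "0 < t"
  shows "G t \<le> (t + bfun p f) / C"
  using G_le_second_moment[OF t] G_le_z[of t] t z_pos
  by (simp add: bfun_def fmean_eq_expectation[OF finite_supp] min_def)

end

section \<open>Finite-horizon coding automata\<close>

text \<open>Mean of the cost \<open>c\<close> on the event of stopping at time \<open>t\<close>, for
  fixed common randomness and message. Cost 1 gives the law of the stopping time, an error indicator
  gives the error probability.\<close>

definition stop_sum ::
  "('x \<Rightarrow> 'y pmf) \<Rightarrow> ('y list \<Rightarrow> 'x) \<Rightarrow> ('y list \<Rightarrow> bool) \<Rightarrow> ('y list \<Rightarrow> real) \<Rightarrow> nat \<Rightarrow> real" where
  "stop_sum W e st c t = (\<Sum>ys | length ys = t.
     if st ys \<and> (\<forall>k<t. \<not> st (take k ys)) then (\<Prod>i<t. pmf (W (e (take i ys))) (ys ! i)) * c ys else 0)"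

lemma stop_sum_0: "stop_sum W e st c 0 = (if st [] then c [] else 0)"
  by (simp add: stop_sum_def)

text \<open>Conditioning on the first output turns the sum over output strings into a recursion on
  the horizon.\<close>

lemma stop_sum_Suc:
  fixes W :: "'x \<Rightarrow> 'y::finite pmf"
  shows "stop_sum W e st c (Suc t) = (if st [] then 0 else
     fmean (W (e [])) (\<lambda>y. stop_sum W (\<lambda>ys. e (y # ys)) (\<lambda>ys. st (y # ys)) (\<lambda>ys. c (y # ys)) t))"
proof -
  let ?F = "\<lambda>ys. if st ys \<and> (\<forall>k<Suc t. \<not> st (take k ys))
    then (\<Prod>i<Suc t. pmf (W (e (take i ys))) (ys ! i)) * c ys else 0"
  have "stop_sum W e st c (Suc t) = (\<Sum>ys\<in>(\<lambda>(y, ys). y # ys) ` (UNIV \<times> {ys. length ys = t}). ?F ys)"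
    unfolding stop_sum_def
    by (rule sum.cong) (auto simp: image_iff length_Suc_conv)
  also have "\<dots> = (\<Sum>(y, ys)\<in>UNIV \<times> {ys. length ys = t}. ?F (y # ys))"
    by (subst sum.reindex) (auto simp: inj_on_def case_prod_unfold)
  also have "\<dots> = (\<Sum>y\<in>UNIV. \<Sum>ys | length ys = t. ?F (y # ys))"
    by (simp add: sum.cartesian_product)
  also have "\<dots> = (\<Sum>y\<in>UNIV. \<Sum>ys | length ys = t. if st [] then 0 else pmf (W (e [])) y *
      (if st (y # ys) \<and> (\<forall>k<t. \<not> st (y # take k ys))
       then (\<Prod>i<t. pmf (W (e (y # take i ys))) (ys ! i)) * c (y # ys) else 0))"
    by (intro sum.cong refl) (auto simp: All_less_Suc2 prod.lessThan_Suc_shift simp del: prod.lessThan_Suc)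
  also have "\<dots> = (if st [] then 0 else
     fmean (W (e [])) (\<lambda>y. stop_sum W (\<lambda>ys. e (y # ys)) (\<lambda>ys. st (y # ys)) (\<lambda>ys. c (y # ys)) t))"
    by (simp add: fmean_UNIV stop_sum_def sum_distrib_left)
  finally show ?thesis .
qed

lemma prob_tau_eq_stop_sum:
  "prob_tau_eq W M PU enc stop t =
     fmean PU (\<lambda>u. (\<Sum>w\<in>{1..M}. stop_sum W (enc u w) (stop u) (\<lambda>_. 1) t) / real M)"
  unfolding prob_tau_eq_def fmean_def stop_sum_def stops_at_def hist_prob_def
  by (intro sum.cong refl arg_cong2[where f = "(*)"]) (auto simp: sum_divide_distrib intro!: sum.cong)

lemma prob_err_tau_eq_stop_sum:
  "prob_err_tau_eq W M PU enc stop dec t =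
     fmean PU (\<lambda>u. (\<Sum>w\<in>{1..M}. stop_sum W (enc u w) (stop u) (\<lambda>ys. of_bool (dec u ys \<noteq> w)) t) / real M)"
  unfolding prob_err_tau_eq_def fmean_def stop_sum_def stops_at_def hist_prob_def
  by (intro sum.cong refl arg_cong2[where f = "(*)"]) (auto simp: sum_divide_distrib intro!: sum.cong)

text \<open>The message will enter through \<open>inp\<close> only. Thus the receiver can follow the
  state from the common randomness and the outputs, and feedback lets the transmitter do the
  same.\<close>

locale coding_automaton =
  fixes W :: "'x \<Rightarrow> 'y::finite pmf"
    and final :: "'s \<Rightarrow> bool"
    and inp :: "'s \<Rightarrow> 'u \<Rightarrow> 'x"
    and step :: "'s \<Rightarrow> 'u \<Rightarrow> 'y \<Rightarrow> 's"
begin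

definition run :: "'s \<Rightarrow> 'u list \<Rightarrow> 'y list \<Rightarrow> 's" where
  "run s us ys = foldl (\<lambda>s (u, y). step s u y) s (zip us ys)"

definition enc_run :: "'s \<Rightarrow> 'u list \<Rightarrow> 'y list \<Rightarrow> 'x" where
  "enc_run s us ys = inp (run s us ys) (us ! length ys)"

text \<open>The length of \<open>us\<close> serves as the horizon: the run is cut off once the
  shared random entries are used up.\<close>

definition stop_run :: "'s \<Rightarrow> 'u list \<Rightarrow> 'y list \<Rightarrow> bool" where
  "stop_run s us ys \<longleftrightarrow> final (run s us ys) \<or> length us \<le> length ys"

primrec exit_cost :: "('s \<Rightarrow> real) \<Rightarrow> 's \<Rightarrow> 'u list \<Rightarrow> real" where
  "exit_cost c s [] = c s"
| "exit_cost c s (u # us) = (if final s then c s else fmean (W (inp s u)) (\<lambda>y. exit_cost c (step s u y) us))"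

primrec exit_time :: "'s \<Rightarrow> 'u list \<Rightarrow> real" where
  "exit_time s [] = 0"
| "exit_time s (u # us) = (if final s then 0 else 1 + fmean (W (inp s u)) (\<lambda>y. exit_time (step s u y) us))"

lemma run_simps [simp]:
  "run s us [] = s" "run s [] ys = s" "run s (u # us) (y # ys) = run (step s u y) us ys"
  by (simp_all add: run_def)

lemma stop_sum_run_0: "stop_sum W (enc_run s us) (stop_run s us) c 0 = (if final s \<or> us = [] then c [] else 0)"
  by (simp add: stop_sum_0 stop_run_def)

lemma stop_sum_run_Nil: "stop_sum W (enc_run s []) (stop_run s []) c (Suc t) = 0"
  by (simp add: stop_sum_Suc stop_run_def)

lemma stop_sum_run_Cons:
  "stop_sum W (enc_run s (u # us)) (stop_run s (u # us)) c (Suc t) = (if final s then 0 else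
     fmean (W (inp s u)) (\<lambda>y. stop_sum W (enc_run (step s u y) us) (stop_run (step s u y) us) (\<lambda>ys. c (y # ys)) t))"
  by (simp add: stop_sum_Suc stop_run_def[abs_def] enc_run_def[abs_def])

lemma stop_sum_run_beyond: "length us < t \<Longrightarrow> stop_sum W (enc_run s us) (stop_run s us) c t = 0"
proof (induction us arbitrary: s c t)
  case Nil
  thus ?case by (cases t) (auto simp: stop_sum_run_Nil)
next
  case (Cons u us)
  then obtain t' where "t = Suc t'" "length us < t'" by (cases t) auto
  thus ?case using Cons.IH by (simp add: stop_sum_run_Cons fmean_const)
qed

text \<open>Links the path sums of the code definition to the backward recursion, on which potential
  arguments work by induction.\<close>

lemma sum_stop_sum_run:
  "(\<Sum>t\<le>length us. stop_sum W (enc_run s us) (stop_run s us) (\<lambda>ys. c (run s us ys)) t) = exit_cost c s us"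
proof (induction us arbitrary: s)
  case Nil
  show ?case by (simp add: stop_sum_run_0)
next
  case (Cons u us)
  show ?case
    by (simp add: sum.atMost_Suc_shift stop_sum_run_0 stop_sum_run_Cons Cons.IH flip: fmean_sum del: sum.atMost_Suc)
qed

lemma exit_cost_const: "exit_cost (\<lambda>_. k) s us = k"
  by (induction us arbitrary: s) (auto simp: fmean_const)

lemma exit_cost_mono: "(\<And>s. c s \<le> d s) \<Longrightarrow> exit_cost c s us \<le> exit_cost d s us"
  by (induction us arbitrary: s) (auto intro: fmean_mono)

lemma exit_cost_add: "exit_cost (\<lambda>s. c s + d s) s us = exit_cost c s us + exit_cost d s us"
  by (induction us arbitrary: s) (auto simp: fmean_add)

lemma sum_time_stop_sum_run:
  "(\<Sum>t\<le>length us. real t * stop_sum W (enc_run s us) (stop_run s us) (\<lambda>_. 1) t) = exit_time s us"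
proof (induction us arbitrary: s)
  case Nil
  show ?case by simp
next
  case (Cons u us)
  show ?case
  proof (cases "final s")
    case True
    thus ?thesis
      by (simp add: sum.atMost_Suc_shift stop_sum_run_Cons del: sum.atMost_Suc)
  next
    case False
    let ?g = "\<lambda>y. stop_sum W (enc_run (step s u y) us) (stop_run (step s u y) us) (\<lambda>_. 1)"
    have "(\<Sum>t\<le>length (u # us). real t * stop_sum W (enc_run s (u # us)) (stop_run s (u # us)) (\<lambda>_. 1) t)
      = (\<Sum>t\<le>length us. real (Suc t) * fmean (W (inp s u)) (\<lambda>y. ?g y t))"
      using False by (simp add: sum.atMost_Suc_shift stop_sum_run_Cons del: sum.atMost_Suc of_nat_Suc)
    also have "\<dots> = fmean (W (inp s u)) (\<lambda>y. (\<Sum>t\<le>length us. real t * ?g y t) + (\<Sum>t\<le>length us. ?g y t))"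
      by (simp add: fmean_add fmean_sum fmean_cmult algebra_simps sum.distrib)
    also have "(\<lambda>y. (\<Sum>t\<le>length us. real t * ?g y t) + (\<Sum>t\<le>length us. ?g y t)) = (\<lambda>y. exit_time (step s u y) us + 1)"
      using sum_stop_sum_run[where c = "\<lambda>_. 1"] by (simp add: Cons.IH exit_cost_const)
    finally show ?thesis using False by (simp add: fmean_add fmean_const)
  qed
qed

text \<open>Markov's inequality: a run cut off in a state that is not final has lasted
  \<open>length us\<close> steps.\<close>

lemma unfinished_le_time:
  "real (length us) * exit_cost (\<lambda>s. of_bool (\<not> final s)) s us \<le> exit_time s us"
proof (induction us arbitrary: s)
  case (Cons u us)
  show ?case
  proof (cases "final s")
    case False
    let ?q = "\<lambda>y. exit_cost (\<lambda>s. of_bool (\<not> final s)) (step s u y) us"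
    have "fmean (W (inp s u)) (\<lambda>y. real (Suc (length us)) * ?q y) \<le> fmean (W (inp s u)) (\<lambda>y. 1 + exit_time (step s u y) us)"
    proof (rule fmean_mono)
      fix y
      have "?q y \<le> 1"
        using exit_cost_mono[of "\<lambda>s. of_bool (\<not> final s)" "\<lambda>_. 1" "step s u y" us] by (simp add: exit_cost_const)
      thus "real (Suc (length us)) * ?q y \<le> 1 + exit_time (step s u y) us"
        using Cons.IH[of "step s u y"] by (simp add: algebra_simps)
    qed
    thus ?thesis using False by (simp add: fmean_linear fmean_const)
  qed simp
qed simp

end

section \<open>Independent random letters and potential bounds\<close>

lemma finite_replicate_pmf: "finite (set_pmf p) \<Longrightarrow> finite (set_pmf (replicate_pmf n p))"
  by (simp add: set_replicate_pmf lists_eq_set finite_lists_length_eq)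

lemma fmean_replicate_Suc:
  assumes "finite (set_pmf p)"
  shows "fmean (replicate_pmf (Suc n) p) f = fmean p (\<lambda>x. fmean (replicate_pmf n p) (\<lambda>xs. f (x # xs)))"
  using assms by (simp add: fmean_bind finite_replicate_pmf)

lemma fmean_swap: "fmean p (\<lambda>a. fmean q (f a)) = fmean q (\<lambda>b. fmean p (\<lambda>a. f a b))"
  unfolding fmean_def sum_distrib_left by (subst sum.swap) (simp add: mult.left_commute)

lemma fmean_replicate_nth:
  assumes "finite (set_pmf p)" "i < n"
  shows "fmean (replicate_pmf n p) (\<lambda>xs. f (xs ! i)) = fmean p f"
  using assms(2)
proof (induction n arbitrary: i)
  case (Suc n)
  thus ?case
    by (cases i) (simp_all add: fmean_replicate_Suc fmean_const finite_replicate_pmf assms(1) del: replicate_pmf.simps)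
qed simp

lemma fmean_replicate_nth2:
  assumes "finite (set_pmf p)" "i < n" "j < n" "i \<noteq> j"
  shows "fmean (replicate_pmf n p) (\<lambda>xs. f (xs ! i) (xs ! j)) = fmean p (\<lambda>x. fmean p (\<lambda>y. f x y))"
  using assms(2-)
proof (induction n arbitrary: i j)
  case (Suc n)
  note simps = fmean_replicate_Suc fmean_const finite_replicate_pmf assms(1)
  consider "i = 0" "j \<noteq> 0" | "i \<noteq> 0" "j = 0" | "i \<noteq> 0" "j \<noteq> 0" using Suc.prems by fastforce
  thus ?case
  proof cases
    case 1
    then obtain j' where j': "j = Suc j'" by (cases j) auto
    show ?thesis using 1 Suc.prems j' fmean_replicate_nth[OF assms(1), of j' n]
      by (simp add: simps del: replicate_pmf.simps)
  next
    case 2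
    then obtain i' where i': "i = Suc i'" by (cases i) auto
    have "fmean (replicate_pmf n p) (\<lambda>xs. f (xs ! i') x) = fmean p (\<lambda>a. f a x)" for x
      by (rule fmean_replicate_nth) (use assms(1) Suc.prems i' in auto)
    thus ?thesis using 2 i' by (simp add: simps del: replicate_pmf.simps) (rule fmean_swap)
  next
    case 3
    then obtain i' j' where "i = Suc i'" "j = Suc j'" by (cases i; cases j) auto
    thus ?thesis using Suc by (simp add: simps del: replicate_pmf.simps)
  qed
qed simp

context coding_automaton
begin

text \<open>Optional stopping for the supermartingale \<open>h\<close>. Every step consumes a fresh
  independent entry of the random list. Domination of \<open>c\<close> is asked for in all states of
  the invariant because the cut-off may occur in any of them.\<close>

lemma exit_cost_le_potential:
  assumes fin: "finite (set_pmf p)"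
    and inv: "\<And>s u y. I s \<Longrightarrow> \<not> final s \<Longrightarrow> I (step s u y)"
    and super: "\<And>s. I s \<Longrightarrow> \<not> final s \<Longrightarrow> fmean p (\<lambda>u. fmean (W (inp s u)) (\<lambda>y. h (step s u y))) \<le> h s"
    and exit: "\<And>s. I s \<Longrightarrow> c s \<le> h s"
    and "I s"
  shows "fmean (replicate_pmf n p) (exit_cost c s) \<le> h s"
  using \<open>I s\<close>
proof (induction n arbitrary: s)
  case 0
  thus ?case using exit by simp
next
  case (Suc n)
  show ?case
  proof (cases "final s")
    case True
    thus ?thesis using exit Suc.prems
      by (simp add: fmean_replicate_Suc fmean_const finite_replicate_pmf fin del: replicate_pmf.simps)
  next
    case False
    have "fmean (replicate_pmf (Suc n) p) (exit_cost c s)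
      = fmean p (\<lambda>u. fmean (W (inp s u)) (\<lambda>y. fmean (replicate_pmf n p) (exit_cost c (step s u y))))"
      using False by (simp add: fmean_replicate_Suc fin fmean_swap[of "replicate_pmf n p"] del: replicate_pmf.simps)
    also have "\<dots> \<le> fmean p (\<lambda>u. fmean (W (inp s u)) (\<lambda>y. h (step s u y)))"
      by (intro fmean_mono Suc.IH inv Suc.prems False)
    finally show ?thesis using super[OF Suc.prems False] by simp
  qed
qed

text \<open>A nonnegative potential that loses at least 1 per step in mean bounds the mean number of
  steps.\<close>

lemma exit_time_le_potential:
  assumes fin: "finite (set_pmf p)"
    and inv: "\<And>s u y. I s \<Longrightarrow> \<not> final s \<Longrightarrow> I (step s u y)"
    and super: "\<And>s. I s \<Longrightarrow> \<not> final s \<Longrightarrow> 1 + fmean p (\<lambda>u. fmean (W (inp s u)) (\<lambda>y. h (step s u y))) \<le> h s"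
    and nonneg: "\<And>s. I s \<Longrightarrow> 0 \<le> h s"
    and "I s"
  shows "fmean (replicate_pmf n p) (exit_time s) \<le> h s"
  using \<open>I s\<close>
proof (induction n arbitrary: s)
  case 0
  thus ?case using nonneg by simp
next
  case (Suc n)
  note simps = fmean_replicate_Suc fmean_const finite_replicate_pmf fin fmean_add
  show ?case
  proof (cases "final s")
    case True
    thus ?thesis using nonneg Suc.prems by (simp add: simps del: replicate_pmf.simps)
  next
    case False
    have "fmean (replicate_pmf (Suc n) p) (exit_time s)
      = 1 + fmean p (\<lambda>u. fmean (W (inp s u)) (\<lambda>y. fmean (replicate_pmf n p) (exit_time (step s u y))))"
      using False by (simp add: simps fmean_swap[of "replicate_pmf n p"] del: replicate_pmf.simps)
    also have "\<dots> \<le> 1 + fmean p (\<lambda>u. fmean (W (inp s u)) (\<lambda>y. h (step s u y)))"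
      by (intro add_left_mono fmean_mono Suc.IH inv Suc.prems False)
    finally show ?thesis using super[OF Suc.prems False] by simp
  qed
qed

end

section \<open>From automata to codes, with time sharing\<close>

lemma fmean_bernoulli_mix:
  assumes q: "0 \<le> q" "q \<le> 1" and fin: "finite (set_pmf R)"
  shows "fmean (bind_pmf (bernoulli_pmf q) (\<lambda>b. if b then return_pmf a else R)) F = q * F a + (1 - q) * fmean R F"
proof -
  have "fmean (bind_pmf (bernoulli_pmf q) (\<lambda>b. if b then return_pmf a else R)) F
    = fmean (bernoulli_pmf q) (\<lambda>b. if b then F a else fmean R F)"
    by (subst fmean_bind) (auto simp: fin finite_subset[OF subset_UNIV] intro!: fmean_cong)
  thus ?thesis using q by (simp add: fmean_UNIV UNIV_bool)
qed

text \<open>With probability \<open>q\<close> the code stops at time 0 and answers 1, which is right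
  with probability \<open>1 / M\<close>; otherwise it runs the automaton up to \<open>T\<close>.
  Every cut-off run is counted as an error.\<close>

lemma vlf_code_of_automaton:
  fixes W :: "'x \<Rightarrow> 'y::finite pmf" and inp :: "nat \<Rightarrow> 's \<Rightarrow> 'u::countable \<Rightarrow> 'x"
    and step :: "'s \<Rightarrow> 'u \<Rightarrow> 'y \<Rightarrow> 's" and dec :: "'s \<Rightarrow> nat"
  assumes M: "1 \<le> M" and T: "0 < T" and q: "0 \<le> q" "q \<le> 1" and fin: "finite (set_pmf p)"
    and dec: "\<And>s. dec s \<in> {1..M}"
    and time: "\<And>w. w \<in> {1..M} \<Longrightarrow>
      fmean (replicate_pmf T p) (coding_automaton.exit_time W final (inp w) step s0) \<le> N'"
    and err: "\<And>w. w \<in> {1..M} \<Longrightarrow>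
      fmean (replicate_pmf T p) (coding_automaton.exit_cost W final (inp w) step (\<lambda>s. of_bool (final s \<and> dec s \<noteq> w)) s0) \<le> e"
    and N: "0 < N" "(1 - q) * N' \<le> N"
    and \<epsilon>: "0 < \<epsilon>" "\<epsilon> < 1" "q * (1 - 1 / real M) + (1 - q) * (e + N' / real T) \<le> \<epsilon>"
  shows "vlf_code W N M \<epsilon>"
proof -
  define R where "R = replicate_pmf T p"
  have finR: "finite (set_pmf R)" unfolding R_def by (rule finite_replicate_pmf[OF fin])
  have lenR: "length us = T" if "us \<in> set_pmf R" for us using that by (simp add: R_def set_replicate_pmf)
  define PU :: "nat pmf" where
    \<comment> \<open>\<open>None\<close> stands for the immediate guess, \<open>Some us\<close> for
      a run on \<open>us\<close>; \<open>to_nat\<close> codes both into the alphabet of the common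
      randomness.\<close>
    "PU = map_pmf to_nat (bind_pmf (bernoulli_pmf q) (\<lambda>b. if b then return_pmf None else map_pmf Some R))"
  define enc where "enc n w = (case from_nat n of None \<Rightarrow> (\<lambda>_. undefined)
    | Some us \<Rightarrow> coding_automaton.enc_run (inp w) step s0 us)" for n w
  define stop where "stop n = (case from_nat n of None \<Rightarrow> (\<lambda>_. True)
    | Some us \<Rightarrow> coding_automaton.stop_run final step s0 us)" for n
  define decode where "decode n ys = (case from_nat n of None \<Rightarrow> 1
    | Some us \<Rightarrow> dec (coding_automaton.run step s0 us ys))" for n and ys :: "'y list"
  define A where "A us w = stop_sum W (coding_automaton.enc_run (inp w) step s0 us) (coding_automaton.stop_run final step s0 us)"
    for us w
  define wrong where "wrong us w ys = (of_bool (dec (coding_automaton.run step s0 us ys) \<noteq> w) :: real)" for us w ys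
  have finB: "finite (set_pmf (bind_pmf (bernoulli_pmf q) (\<lambda>b. if b then return_pmf None else map_pmf Some R)))"
    using finR by (auto simp: finite_subset[OF subset_UNIV])
  have finPU: "finite (set_pmf PU)" unfolding PU_def using finB by (simp only: set_map_pmf finite_imageI)
  have mean_PU: "fmean PU F = q * F (to_nat (None :: 'u list option)) + (1 - q) * fmean R (\<lambda>us. F (to_nat (Some us)))" for F
    unfolding PU_def using finR by (simp add: fmean_map[OF finB] fmean_bernoulli_mix[OF q] fmean_map)
  have stop_None: "stop_sum W e (\<lambda>_. True) c t = (if t = 0 then c [] else 0)" for e c t
    by (cases t) (auto simp: stop_sum_0 stop_sum_Suc)
  have pt: "prob_tau_eq W M PU enc stop t =
      q * of_bool (t = 0) + (1 - q) * fmean R (\<lambda>us. (\<Sum>w\<in>{1..M}. A us w (\<lambda>_. 1) t) / real M)" for t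
    unfolding prob_tau_eq_stop_sum mean_PU using M by (simp add: enc_def stop_def A_def stop_None)
  have "(\<Sum>w\<in>{1..M}. of_bool (1 \<noteq> w)) = (\<Sum>w\<in>{1..M}. 1 - (if w = 1 then 1 else 0 :: real))"
    by (rule sum.cong) auto
  also have "\<dots> = real M - 1" using M by (simp add: sum_subtractf)
  finally have guess: "(\<Sum>w\<in>{1..M}. of_bool (1 \<noteq> w)) = real M - 1" .
  have pe: "prob_err_tau_eq W M PU enc stop decode t =
      q * (of_bool (t = 0) * (1 - 1 / real M)) + (1 - q) * fmean R (\<lambda>us. (\<Sum>w\<in>{1..M}. A us w (wrong us w) t) / real M)" for t
    unfolding prob_err_tau_eq_stop_sum mean_PU using M guess
    by (simp add: enc_def stop_def decode_def A_def wrong_def[abs_def] stop_None right_diff_distrib diff_divide_distrib)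
  have A_beyond: "A us w c t = 0" if "us \<in> set_pmf R" "T < t" for us w c t
    unfolding A_def using coding_automaton.stop_sum_run_beyond lenR[OF that(1)] that(2) by metis
  have beyond: "fmean R (\<lambda>us. (\<Sum>w\<in>{1..M}. A us w (c us w) t) / real M) = 0" if "T < t" for c t
    using A_beyond[OF _ that] by (subst fmean_cong[where g = "\<lambda>_. 0"]) (auto simp: fmean_const finR)
  have pt0: "prob_tau_eq W M PU enc stop t = 0" and pe0: "prob_err_tau_eq W M PU enc stop decode t = 0"
    if "t \<notin> {..T}" for t
    using that beyond[of t] by (auto simp: pt pe)
  have swap: "(\<Sum>t\<le>T. r t * fmean R (\<lambda>us. (\<Sum>w\<in>{1..M}. A us w (c us w) t) / real M)) =
      (\<Sum>w\<in>{1..M}. fmean R (\<lambda>us. \<Sum>t\<le>length us. r t * A us w (c us w) t)) / real M" for c and r :: "nat \<Rightarrow> real"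
  proof -
    have "(\<Sum>t\<le>T. r t * fmean R (\<lambda>us. (\<Sum>w\<in>{1..M}. A us w (c us w) t) / real M))
      = fmean R (\<lambda>us. (\<Sum>t\<le>T. \<Sum>w\<in>{1..M}. r t * A us w (c us w) t)) / real M"
      by (simp add: fmean_sum fmean_divide sum_divide_distrib sum_distrib_left fmean_cmult)
    also have "\<dots> = fmean R (\<lambda>us. (\<Sum>w\<in>{1..M}. \<Sum>t\<le>length us. r t * A us w (c us w) t)) / real M"
      by (intro arg_cong2[where f = "(/)"] refl fmean_cong, subst sum.swap) (simp add: lenR)
    finally show ?thesis by (simp add: fmean_sum)
  qed
  have zero: "(\<Sum>t\<le>T. g t * of_bool (t = 0)) = (g 0 :: real)" for g
    by (subst sum.remove[of _ 0]) auto
  have total: "(\<Sum>t\<le>T. prob_tau_eq W M PU enc stop t) = 1"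
  proof -
    have "(\<Sum>t\<le>length us. A us w (\<lambda>_. 1) t) = 1" for us w
      unfolding A_def
      using coding_automaton.sum_stop_sum_run[of W "inp w" step s0 us final "\<lambda>_. 1"]
      by (simp add: coding_automaton.exit_cost_const)
    thus ?thesis
      using swap[of "\<lambda>_. 1" "\<lambda>_ _ _. 1"] zero[of "\<lambda>_. q"] M
      by (simp add: pt sum.distrib fmean_const finR flip: sum_distrib_left)
  qed
  have mean_time: "(\<Sum>t\<le>T. real t * prob_tau_eq W M PU enc stop t) \<le> (1 - q) * N'"
  proof -
    have "(\<Sum>w\<in>{1..M}. fmean R (\<lambda>us. \<Sum>t\<le>length us. real t * A us w (\<lambda>_. 1) t)) \<le> (\<Sum>w\<in>{1..M}. N')"
      unfolding A_def coding_automaton.sum_time_stop_sum_run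
      by (rule sum_mono) (use time in \<open>simp add: R_def\<close>)
    hence "(\<Sum>w\<in>{1..M}. fmean R (\<lambda>us. \<Sum>t\<le>length us. real t * A us w (\<lambda>_. 1) t)) / real M \<le> N'"
      using M by (simp add: field_simps)
    hence "(1 - q) * (\<Sum>t\<le>T. real t * fmean R (\<lambda>us. (\<Sum>w\<in>{1..M}. A us w (\<lambda>_. 1) t) / real M)) \<le> (1 - q) * N'"
      unfolding swap[of real "\<lambda>_ _ _. 1"] using q by (intro mult_left_mono) auto
    moreover have "(\<Sum>t\<le>T. real t * prob_tau_eq W M PU enc stop t) =
      (\<Sum>t\<le>T. real t * q * of_bool (t = 0)) + (1 - q) * (\<Sum>t\<le>T. real t * fmean R (\<lambda>us. (\<Sum>w\<in>{1..M}. A us w (\<lambda>_. 1) t) / real M))"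
      by (simp add: pt sum_distrib_left distrib_left sum.distrib mult_ac)
    ultimately show ?thesis unfolding zero by simp
  qed
  have error: "(\<Sum>t\<le>T. prob_err_tau_eq W M PU enc stop decode t) \<le> q * (1 - 1 / real M) + (1 - q) * (e + N' / real T)"
  proof -
    have "fmean R (\<lambda>us. \<Sum>t\<le>length us. 1 * A us w (wrong us w) t) \<le> e + N' / real T" if w: "w \<in> {1..M}" for w
    proof -
      interpret coding_automaton W final "inp w" step .
      \<comment> \<open>A wrong answer comes from a final state that names another message or from a
        cut-off.\<close>
      have "(\<Sum>t\<le>length us. 1 * A us w (wrong us w) t) \<le>
          exit_cost (\<lambda>s. of_bool (final s \<and> dec s \<noteq> w)) s0 us + exit_cost (\<lambda>s. of_bool (\<not> final s)) s0 us" for us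
        unfolding A_def wrong_def mult_1 sum_stop_sum_run[where c = "\<lambda>s. of_bool (dec s \<noteq> w)"] exit_cost_add[symmetric]
        by (rule exit_cost_mono) auto
      hence "fmean R (\<lambda>us. \<Sum>t\<le>length us. 1 * A us w (wrong us w) t) \<le>
        fmean R (\<lambda>us. exit_cost (\<lambda>s. of_bool (final s \<and> dec s \<noteq> w)) s0 us + exit_cost (\<lambda>s. of_bool (\<not> final s)) s0 us)"
        by (intro fmean_mono)
      also have "\<dots> \<le> e + fmean R (exit_cost (\<lambda>s. of_bool (\<not> final s)) s0)"
        using err[OF w] by (simp add: fmean_add R_def)
      also have "fmean R (exit_cost (\<lambda>s. of_bool (\<not> final s)) s0) \<le> N' / real T"
      proof -
        have "fmean R (\<lambda>us. real T * exit_cost (\<lambda>s. of_bool (\<not> final s)) s0 us) \<le> fmean R (exit_time s0)"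
          by (rule fmean_mono) (use unfinished_le_time lenR in metis)
        also have "\<dots> \<le> N'" using time[OF w] by (simp add: R_def)
        finally show ?thesis using T by (simp add: fmean_cmult field_simps)
      qed
      finally show ?thesis by simp
    qed
    hence "(\<Sum>w\<in>{1..M}. fmean R (\<lambda>us. \<Sum>t\<le>length us. 1 * A us w (wrong us w) t)) \<le> (\<Sum>w\<in>{1..M}. e + N' / real T)"
      by (rule sum_mono)
    hence "(\<Sum>w\<in>{1..M}. fmean R (\<lambda>us. \<Sum>t\<le>length us. 1 * A us w (wrong us w) t)) / real M \<le> e + N' / real T"
      using M by (simp add: pos_divide_le_eq mult.commute)
    hence "(1 - q) * (\<Sum>t\<le>T. 1 * fmean R (\<lambda>us. (\<Sum>w\<in>{1..M}. A us w (wrong us w) t) / real M)) \<le> (1 - q) * (e + N' / real T)"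
      unfolding swap[of "\<lambda>_. 1" wrong] using q by (intro mult_left_mono) auto
    moreover have "(\<Sum>t\<le>T. prob_err_tau_eq W M PU enc stop decode t) =
      (\<Sum>t\<le>T. (q * (1 - 1 / real M)) * of_bool (t = 0)) + (1 - q) * (\<Sum>t\<le>T. 1 * fmean R (\<lambda>us. (\<Sum>w\<in>{1..M}. A us w (wrong us w) t) / real M))"
      by (simp add: pe sum_distrib_left sum.distrib mult_ac)
    ultimately show ?thesis unfolding zero by simp
  qed
  have "decode u ys \<in> {1..M}" for u ys
    using dec M by (simp add: decode_def split: option.split)
  moreover have "(\<lambda>t. prob_tau_eq W M PU enc stop t) sums 1"
    using sums_finite[of "{..T}" "prob_tau_eq W M PU enc stop"] pt0 total by simp
  moreover have "(\<lambda>t. real t * prob_tau_eq W M PU enc stop t) sums (\<Sum>t\<le>T. real t * prob_tau_eq W M PU enc stop t)"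
    by (rule sums_finite) (use pt0 in auto)
  moreover have "(\<lambda>t. prob_err_tau_eq W M PU enc stop decode t) sums (\<Sum>t\<le>T. prob_err_tau_eq W M PU enc stop decode t)"
    by (rule sums_finite) (use pe0 in auto)
  ultimately show ?thesis
    unfolding vlf_code_def using finPU M N \<epsilon> mean_time error
    by (intro conjI exI[of _ PU] exI[of _ enc] exI[of _ stop] exI[of _ decode])
       (auto simp: sums_iff)
qed

section \<open>Divergence and mutual information\<close>

lemma kl_div_fmean: "kl_div P Q = fmean P (\<lambda>y. ln (pmf P y / pmf Q y))" for P :: "'y::finite pmf"
  by (simp add: kl_div_def fmean_eq_expectation)

text \<open>Gibbs' inequality from \<open>ln x \<le> x - 1\<close>, which is strict at a letter
  where \<open>P\<close> exceeds \<open>Q\<close>. The support inclusion keeps the ratios positive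
  on the support of \<open>P\<close>.\<close>

lemma kl_div_pos:
  fixes P Q :: "'y::finite pmf"
  assumes sub: "set_pmf P \<subseteq> set_pmf Q" and "P \<noteq> Q"
  shows "0 < kl_div P Q"
proof -
  obtain y0 where y0: "pmf Q y0 < pmf P y0"
    using \<open>P \<noteq> Q\<close> pmf_neq_exists_less[of Q P] by blast
  have y0P: "y0 \<in> set_pmf P" using y0 pmf_nonneg[of Q y0] by (auto simp: set_pmf_iff)
  have pos: "0 < pmf P y" "0 < pmf Q y" if "y \<in> set_pmf P" for y
    using that sub by (auto simp: pmf_positive)
  have ln_swap: "ln (pmf P y / pmf Q y) = - ln (pmf Q y / pmf P y)" if "y \<in> set_pmf P" for y
    using pos[OF that] by (simp add: ln_div)
  have "(\<Sum>y\<in>set_pmf P. pmf P y * (1 - pmf Q y / pmf P y)) < (\<Sum>y\<in>set_pmf P. pmf P y * ln (pmf P y / pmf Q y))"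
  proof (rule sum_strict_mono_ex1)
    show "\<forall>y\<in>set_pmf P. pmf P y * (1 - pmf Q y / pmf P y) \<le> pmf P y * ln (pmf P y / pmf Q y)"
    proof
      fix y assume y: "y \<in> set_pmf P"
      show "pmf P y * (1 - pmf Q y / pmf P y) \<le> pmf P y * ln (pmf P y / pmf Q y)"
        using ln_le_minus_one[of "pmf Q y / pmf P y"] pos[OF y] ln_swap[OF y] by (intro mult_left_mono) auto
    qed
    have "ln (pmf Q y0 / pmf P y0) \<noteq> pmf Q y0 / pmf P y0 - 1"
      using ln_eq_minus_one[of "pmf Q y0 / pmf P y0"] pos[OF y0P] y0 by auto
    hence "1 - pmf Q y0 / pmf P y0 < ln (pmf P y0 / pmf Q y0)"
      using ln_le_minus_one[of "pmf Q y0 / pmf P y0"] pos[OF y0P] ln_swap[OF y0P] by auto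
    thus "\<exists>y\<in>set_pmf P. pmf P y * (1 - pmf Q y / pmf P y) < pmf P y * ln (pmf P y / pmf Q y)"
      using y0P pos[OF y0P] by (intro bexI[of _ y0] mult_strict_left_mono) auto
  qed simp
  also have "\<dots> = kl_div P Q" by (simp add: kl_div_fmean fmean_def)
  also have "(\<Sum>y\<in>set_pmf P. pmf P y * (1 - pmf Q y / pmf P y)) = (\<Sum>y\<in>set_pmf P. pmf P y - pmf Q y)"
    using pos by (intro sum.cong refl) (force simp: field_simps)
  finally have "(\<Sum>y\<in>set_pmf P. pmf P y) - (\<Sum>y\<in>set_pmf P. pmf Q y) < kl_div P Q"
    by (simp add: sum_subtractf)
  moreover have "(\<Sum>y\<in>set_pmf P. pmf P y) = 1" by (rule sum_pmf_eq_1) auto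
  moreover have "(\<Sum>y\<in>set_pmf P. pmf Q y) \<le> 1"
    using measure_measure_pmf_finite[of "set_pmf P" Q] measure_pmf.prob_le_1[of Q "set_pmf P"] by simp
  ultimately show ?thesis by linarith
qed

lemma kl_div_self [simp]: "kl_div P P = 0"
proof -
  have "ln (pmf P y / pmf P y) = 0" for y by (cases "pmf P y = 0") auto
  thus ?thesis by (simp add: kl_div_def)
qed

lemma mutual_info_const: "mutual_info (\<lambda>_. V) PX = 0"
proof -
  have "ln (pmf V y / pmf V y) = 0" for y by (cases "pmf V y = 0") auto
  thus ?thesis by (simp add: mutual_info_def info_density_def out_dist_def case_prod_unfold)
qed

lemma fmean_joint_dist:
  fixes W :: "'x::finite \<Rightarrow> 'y::finite pmf"
  shows "fmean (joint_dist W PX) F = fmean PX (\<lambda>x. fmean (W x) (\<lambda>y. F (x, y)))"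
  by (simp add: joint_dist_def fmean_bind fmean_map)

lemma pmf_out_dist:
  fixes W :: "'x::finite \<Rightarrow> 'y pmf"
  shows "pmf (out_dist W PX) y = fmean PX (\<lambda>x. pmf (W x) y)"
  by (simp add: out_dist_def pmf_bind fmean_eq_expectation)

section \<open>Communication, confirmation and resumption\<close>

text \<open>The function argument holds the accumulated information density of every message; \<open>Conf m l\<close> is the
  confirmation of the tentative decision \<open>m\<close> with accumulated log-likelihood ratio \<open>l\<close> of \<open>xA\<close> against \<open>xR\<close>.\<close>

datatype phase =
    Comm "nat \<Rightarrow> real"
  | Conf nat real "nat \<Rightarrow> real"
  | Resume "nat \<Rightarrow> real"
  | Done nat

primrec finished :: "phase \<Rightarrow> bool" where
  "finished (Comm \<sigma>) = False"
| "finished (Conf m l \<sigma>) = False"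
| "finished (Resume \<sigma>) = False"
| "finished (Done m) = True"

locale confirm_scheme =
  fixes W :: "'x::finite \<Rightarrow> 'y::finite pmf"
    and PX :: "'x pmf" and M :: nat and \<gamma>1 \<gamma>2 aA aR :: real and xA xR :: 'x
  assumes same_supp: "\<And>x x' y. 0 < pmf (W x) y \<Longrightarrow> 0 < pmf (W x') y"
    and info_pos: "0 < mutual_info W PX"
    and DA_pos: "0 < kl_div (W xA) (W xR)"
    and DR_pos: "0 < kl_div (W xR) (W xA)"
    and M_pos: "1 \<le> M"
    and g1_pos: "0 < \<gamma>1" and g12: "\<gamma>1 < \<gamma>2"
    and aA_pos: "0 < aA" and aR_pos: "0 < aR"
begin

definition llr :: "'y \<Rightarrow> real" where "llr y = ln (pmf (W xA) y / pmf (W xR) y)"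

definition llr' :: "'y \<Rightarrow> real" where "llr' y = ln (pmf (W xR) y / pmf (W xA) y)"

abbreviation info :: "'x \<times> 'y \<Rightarrow> real" where "info \<equiv> \<lambda>(x, y). info_density W PX x y"

text \<open>In each use of the channel \<open>u\<close> holds one letter for every message; messages
  start at 1 and list positions at 0.\<close>

definition update :: "(nat \<Rightarrow> real) \<Rightarrow> 'x list \<Rightarrow> 'y \<Rightarrow> nat \<Rightarrow> real" where
  "update \<sigma> u y = (\<lambda>m. \<sigma> m + info_density W PX (u ! (m - 1)) y)"

definition winner :: "real \<Rightarrow> (nat \<Rightarrow> real) \<Rightarrow> nat" where
  "winner \<gamma> \<sigma> = (SOME m. m \<in> {1..M} \<and> \<gamma> \<le> \<sigma> m)"

definition comm :: "(nat \<Rightarrow> real) \<Rightarrow> phase" where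
  "comm \<sigma> = (if \<exists>m\<in>{1..M}. \<gamma>1 \<le> \<sigma> m then Conf (winner \<gamma>1 \<sigma>) 0 \<sigma> else Comm \<sigma>)"

text \<open>Also entered directly after a rejection: the scores are kept, and if one already reaches
  \<open>\<gamma>2\<close>, the code stops without another transmission.\<close>

definition resume :: "(nat \<Rightarrow> real) \<Rightarrow> phase" where
  "resume \<sigma> = (if \<exists>m\<in>{1..M}. \<gamma>2 \<le> \<sigma> m then Done (winner \<gamma>2 \<sigma>) else Resume \<sigma>)"

primrec step :: "phase \<Rightarrow> 'x list \<Rightarrow> 'y \<Rightarrow> phase" where
  "step (Comm \<sigma>) u y = comm (update \<sigma> u y)"
| "step (Conf m l \<sigma>) u y =
     (if aA \<le> l + llr y then Done m else if l + llr y \<le> - aR then resume \<sigma> else Conf m (l + llr y) \<sigma>)"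
| "step (Resume \<sigma>) u y = resume (update \<sigma> u y)"
| "step (Done m) u y = Done m"

primrec inp :: "nat \<Rightarrow> phase \<Rightarrow> 'x list \<Rightarrow> 'x" where
  "inp w (Comm \<sigma>) u = u ! (w - 1)"
| "inp w (Conf m l \<sigma>) u = (if m = w then xA else xR)"
| "inp w (Resume \<sigma>) u = u ! (w - 1)"
| "inp w (Done m) u = xA"

text \<open>The value 1 is a default for cut-off runs, since a decoder must name a message after
  every history.\<close>

definition dec :: "phase \<Rightarrow> nat" where
  "dec s = (case s of Done m \<Rightarrow> if m \<in> {1..M} then m else 1 | _ \<Rightarrow> 1)"

lemma dec_in: "dec s \<in> {1..M}"
  using M_pos by (auto simp: dec_def split: phase.split)

lemma winner:
  assumes "\<exists>m\<in>{1..M}. \<gamma> \<le> \<sigma> m"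
  shows "winner \<gamma> \<sigma> \<in> {1..M}" "\<gamma> \<le> \<sigma> (winner \<gamma> \<sigma>)"
  using assms someI_ex[of "\<lambda>m. m \<in> {1..M} \<and> \<gamma> \<le> \<sigma> m"] unfolding winner_def by blast+

sublocale J: drift_walk "joint_dist W PX" info
  by standard (use info_pos in \<open>simp_all add: mutual_info_def fmean_eq_expectation\<close>)

sublocale A: drift_walk "W xA" llr
  by standard (use DA_pos in \<open>simp_all add: kl_div_fmean llr_def[abs_def]\<close>)

sublocale R: drift_walk "W xR" llr'
  by standard (use DR_pos in \<open>simp_all add: kl_div_fmean llr'_def[abs_def]\<close>)

lemma llr'_eq: "llr' y = - llr y"
  unfolding llr_def llr'_def by (metis inverse_divide ln_inverse)

lemma positive_everywhere: "y \<in> set_pmf (W x) \<Longrightarrow> 0 < pmf (W x') y"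
  using same_supp by (simp add: pmf_positive_iff)

text \<open>Change of measure from \<open>xA\<close> to \<open>xR\<close>; equal supports make the
  total mass exactly 1.\<close>

lemma exp_neg_llr_mean: "fmean (W xA) (\<lambda>y. exp (- llr y)) = 1"
proof -
  have "fmean (W xA) (\<lambda>y. exp (- llr y)) = (\<Sum>y\<in>set_pmf (W xA). pmf (W xR) y)"
    unfolding fmean_def
    by (intro sum.cong refl)
       (use positive_everywhere in \<open>simp add: llr'_eq[symmetric] llr'_def less_imp_neq[THEN not_sym]\<close>)
  also have "\<dots> = 1"
    by (rule sum_pmf_eq_1) (use positive_everywhere in \<open>auto simp: pmf_positive_iff[symmetric]\<close>)
  finally show ?thesis .
qed

lemma exp_llr_mean: "fmean (W xR) (\<lambda>y. exp (llr y)) = 1"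
proof -
  have "fmean (W xR) (\<lambda>y. exp (llr y)) = (\<Sum>y\<in>set_pmf (W xR). pmf (W xA) y)"
    unfolding fmean_def
    by (intro sum.cong refl)
       (use positive_everywhere in \<open>simp add: llr_def less_imp_neq[THEN not_sym]\<close>)
  also have "\<dots> = 1"
    by (rule sum_pmf_eq_1) (use positive_everywhere in \<open>auto simp: pmf_positive_iff[symmetric]\<close>)
  finally show ?thesis .
qed

abbreviation letters :: "'x list pmf" where "letters \<equiv> replicate_pmf M PX"

lemma finite_letters: "finite (set_pmf letters)"
  by (rule finite_replicate_pmf) simp

lemma true_message_mean:
  assumes "w \<in> {1..M}"
  shows "fmean letters (\<lambda>u. fmean (W (u ! (w - 1))) (\<lambda>y. F (info_density W PX (u ! (w - 1)) y)))
    = fmean (joint_dist W PX) (\<lambda>a. F (info a))"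
  unfolding fmean_joint_dist
  by (subst fmean_replicate_nth[where f = "\<lambda>x. fmean (W x) (\<lambda>y. F (info_density W PX x y))"]) (use assms in auto)

text \<open>The letter of a wrong message is independent of the output, and averaging
  \<open>pmf (W x') y\<close> over that letter reproduces the output probability in the
  denominator.\<close>

lemma wrong_message_mean:
  assumes w: "w \<in> {1..M}" and m: "m \<in> {1..M}" and "m \<noteq> w"
  shows "fmean letters (\<lambda>u. fmean (W (u ! (w - 1))) (\<lambda>y. exp (info_density W PX (u ! (m - 1)) y))) = 1"
proof -
  have "fmean letters (\<lambda>u. fmean (W (u ! (w - 1))) (\<lambda>y. exp (info_density W PX (u ! (m - 1)) y)))
    = fmean PX (\<lambda>x. fmean PX (\<lambda>x'. fmean (W x) (\<lambda>y. exp (info_density W PX x' y))))"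
    by (rule fmean_replicate_nth2[where f = "\<lambda>x x'. fmean (W x) (\<lambda>y. exp (info_density W PX x' y))"])
       (use assms in auto)
  also have "\<dots> = fmean PX (\<lambda>x. 1)"
  proof (rule fmean_cong)
    fix x
    have "fmean PX (\<lambda>x'. exp (info_density W PX x' y)) = 1" if y: "y \<in> set_pmf (W x)" for y
    proof -
      have out: "0 < pmf (out_dist W PX) y"
      proof -
        obtain x' where "x' \<in> set_pmf PX" using set_pmf_not_empty[of PX] by blast
        hence "y \<in> set_pmf (out_dist W PX)"
          using positive_everywhere[OF y, of x'] by (auto simp: out_dist_def pmf_positive_iff)
        thus ?thesis by (simp add: pmf_positive)
      qed
      have "fmean PX (\<lambda>x'. exp (info_density W PX x' y)) = fmean PX (\<lambda>x'. pmf (W x') y / pmf (out_dist W PX) y)"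
        by (rule fmean_cong) (use positive_everywhere[OF y] out in \<open>simp add: info_density_def\<close>)
      thus ?thesis using out by (simp add: fmean_divide flip: pmf_out_dist)
    qed
    thus "fmean PX (\<lambda>x'. fmean (W x) (\<lambda>y. exp (info_density W PX x' y))) = 1"
      by (subst fmean_swap) (simp add: fmean_const cong: fmean_cong)
  qed
  finally show ?thesis by (simp add: fmean_const)
qed

text \<open>The messages over which the union bound for a wrong decision runs.\<close>

abbreviation others :: "nat \<Rightarrow> nat set" where "others w \<equiv> {1..M} - {w}"

text \<open>A union bound over the wrong messages: it is at least 1 once one of them reaches
  \<open>\<gamma>\<close>, and it keeps its mean while letters are sent.\<close>

definition overtake :: "nat \<Rightarrow> real \<Rightarrow> (nat \<Rightarrow> real) \<Rightarrow> real" where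
  "overtake w \<gamma> \<sigma> = (\<Sum>m\<in>others w. exp (\<sigma> m - \<gamma>))"

lemma overtake_nonneg: "0 \<le> overtake w \<gamma> \<sigma>"
  by (simp add: overtake_def sum_nonneg)

lemma overtake_ge_1:
  assumes "\<exists>m\<in>{1..M}. \<gamma> \<le> \<sigma> m" "winner \<gamma> \<sigma> \<noteq> w"
  shows "1 \<le> overtake w \<gamma> \<sigma>"
proof -
  have "1 \<le> exp (\<sigma> (winner \<gamma> \<sigma>) - \<gamma>)" using winner[OF assms(1)] by simp
  also have "\<dots> \<le> overtake w \<gamma> \<sigma>" unfolding overtake_def
    by (rule member_le_sum) (use winner[OF assms(1)] assms(2) in auto)
  finally show ?thesis .
qed

lemma overtake_mean:
  assumes w: "w \<in> {1..M}"
  shows "fmean letters (\<lambda>u. fmean (W (u ! (w - 1))) (\<lambda>y. overtake w \<gamma> (update \<sigma> u y))) = overtake w \<gamma> \<sigma>"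
proof -
  have "overtake w \<gamma> (update \<sigma> u y) = (\<Sum>m\<in>others w. exp (\<sigma> m - \<gamma>) * exp (info_density W PX (u ! (m - 1)) y))" for u y
    by (simp add: overtake_def update_def flip: exp_add) (simp add: algebra_simps)
  thus ?thesis
    using wrong_message_mean[OF w]
    by (simp add: fmean_sum fmean_cmult) (simp add: overtake_def)
qed

lemma overtake_init:
  assumes "w \<in> {1..M}"
  shows "overtake w \<gamma> (\<lambda>_. 0) = (real M - 1) * exp (- \<gamma>)"
  using assms M_pos by (simp add: overtake_def card_Diff_singleton of_nat_diff)

lemma overtake_shift: "overtake w (\<gamma> + a) \<sigma> = exp (- a) * overtake w \<gamma> \<sigma>"
  by (simp add: overtake_def sum_distrib_left flip: exp_add) (simp add: algebra_simps)

text \<open>Bounds the probability of finishing wrongly from each state. During \<open>Comm\<close>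
  the two terms stand for a false acceptance after a wrong tentative decision and for a wrong winner
  at \<open>\<gamma>2\<close>; \<open>exp (l - aA)\<close> bounds the chance that a pending wrong
  decision is accepted.\<close>

primrec err_pot :: "nat \<Rightarrow> phase \<Rightarrow> real" where
  "err_pot w (Comm \<sigma>) = overtake w (\<gamma>1 + aA) \<sigma> + overtake w \<gamma>2 \<sigma>"
| "err_pot w (Conf m l \<sigma>) = (if m = w then 0 else exp (l - aA)) + overtake w \<gamma>2 \<sigma>"
| "err_pot w (Resume \<sigma>) = overtake w \<gamma>2 \<sigma>"
| "err_pot w (Done m) = of_bool (m \<noteq> w)"

lemma err_pot_resume: "err_pot w (resume \<sigma>) \<le> overtake w \<gamma>2 \<sigma>"
  using overtake_ge_1[of \<gamma>2 \<sigma> w] overtake_nonneg[of w \<gamma>2 \<sigma>] by (auto simp: resume_def)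

text \<open>A wrong winner at \<open>\<gamma>1\<close> makes \<open>overtake w \<gamma>1\<close> at
  least 1, so the term with threshold \<open>\<gamma>1 + aA\<close> covers the factor
  \<open>exp (- aA)\<close> at the start of the confirmation.\<close>

lemma err_pot_comm: "err_pot w (comm \<sigma>) \<le> err_pot w (Comm \<sigma>)"
  using overtake_ge_1[of \<gamma>1 \<sigma> w] overtake_nonneg[of w "\<gamma>1 + aA" \<sigma>]
  by (auto simp: comm_def overtake_shift)

lemma err_pot_step:
  assumes w: "w \<in> {1..M}" and s: "\<not> finished s"
  shows "fmean letters (\<lambda>u. fmean (W (inp w s u)) (\<lambda>y. err_pot w (step s u y))) \<le> err_pot w s"
proof (cases s)
  case (Comm \<sigma>)
  have "fmean letters (\<lambda>u. fmean (W (inp w s u)) (\<lambda>y. err_pot w (step s u y)))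
    \<le> fmean letters (\<lambda>u. fmean (W (u ! (w - 1))) (\<lambda>y. err_pot w (Comm (update \<sigma> u y))))"
    unfolding Comm inp.simps step.simps by (intro fmean_mono err_pot_comm)
  thus ?thesis using Comm by (simp add: fmean_add overtake_mean[OF w, simplified])
next
  case (Resume \<sigma>)
  have "fmean letters (\<lambda>u. fmean (W (inp w s u)) (\<lambda>y. err_pot w (step s u y)))
    \<le> fmean letters (\<lambda>u. fmean (W (u ! (w - 1))) (\<lambda>y. overtake w \<gamma>2 (update \<sigma> u y)))"
    unfolding Resume inp.simps step.simps by (intro fmean_mono err_pot_resume)
  thus ?thesis using Resume by (simp add: overtake_mean[OF w, simplified])
next
  case (Conf m l \<sigma>)
  show ?thesis
  proof (cases "m = w")
    case True
    have "fmean (W xA) (\<lambda>y. err_pot w (step s u y)) \<le> fmean (W xA) (\<lambda>y. overtake w \<gamma>2 \<sigma>)" for u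
      by (rule fmean_mono) (use True Conf err_pot_resume overtake_nonneg in auto)
    hence "fmean letters (\<lambda>u. fmean (W xA) (\<lambda>y. err_pot w (step s u y))) \<le> fmean letters (\<lambda>u. overtake w \<gamma>2 \<sigma>)"
      by (intro fmean_mono) (simp add: fmean_const)
    thus ?thesis using Conf True by (simp add: fmean_const finite_letters)
  next
    case False
    \<comment> \<open>Under \<open>xR\<close> the factor \<open>exp (llr y)\<close> has mean 1. At
      acceptance \<open>exp (l + llr y - aA)\<close> is at least 1, and at rejection it is simply
      dropped.\<close>
    have "fmean (W xR) (\<lambda>y. err_pot w (step s u y)) \<le> fmean (W xR) (\<lambda>y. exp (l - aA) * exp (llr y) + overtake w \<gamma>2 \<sigma>)" for u
    proof (rule fmean_mono)
      fix y
      have "exp (l - aA) * exp (llr y) = exp (l + llr y - aA)" by (simp flip: exp_add)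
      moreover have "aA \<le> l + llr y \<Longrightarrow> 1 \<le> exp (l + llr y - aA)" by simp
      moreover have "0 \<le> exp (l + llr y - aA)" by simp
      ultimately show "err_pot w (step s u y) \<le> exp (l - aA) * exp (llr y) + overtake w \<gamma>2 \<sigma>"
        using Conf False err_pot_resume[of w \<sigma>] overtake_nonneg[of w \<gamma>2 \<sigma>]
        by (auto simp del: exp_ge_zero one_le_exp_iff)
    qed
    hence "fmean (W xR) (\<lambda>y. err_pot w (step s u y)) \<le> err_pot w s" for u
      using Conf False by (simp add: fmean_linear fmean_const exp_llr_mean)
    hence "fmean letters (\<lambda>u. fmean (W xR) (\<lambda>y. err_pot w (step s u y))) \<le> fmean letters (\<lambda>u. err_pot w s)"
      by (rule fmean_mono)
    thus ?thesis using Conf False by (simp add: fmean_const finite_letters)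
  qed
qed (use s in simp)

text \<open>Up to the confirmation phase, communication ends no later than the first passage of the true message's own
  score. If a wrong message wins first, that score may still lie below \<open>\<gamma>1\<close>; subadditivity of the mean
  crossing time splits the remaining way to \<open>\<gamma>2\<close> at \<open>\<gamma>1\<close>, so the same bound covers this case.\<close>

primrec time_pot :: "nat \<Rightarrow> phase \<Rightarrow> real" where
  "time_pot w (Comm \<sigma>) = J.G (\<gamma>1 - \<sigma> w) + overtake w \<gamma>1 \<sigma> * (R.G aR + J.G (\<gamma>2 - \<gamma>1))
     + A.G aA + exp (- aR) * J.G (\<gamma>2 - \<gamma>1)"
| "time_pot w (Conf m l \<sigma>) =
     (if m = w then A.G (aA - l) + exp (- aR - l) * J.G (\<gamma>2 - \<sigma> w) else R.G (aR + l) + J.G (\<gamma>2 - \<sigma> w))"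
| "time_pot w (Resume \<sigma>) = J.G (\<gamma>2 - \<sigma> w)"
| "time_pot w (Done m) = 0"

text \<open>Keeps the remaining distances positive wherever the renewal equation of \<open>G\<close>
  is applied.\<close>

primrec proper :: "nat \<Rightarrow> phase \<Rightarrow> bool" where
  "proper w (Comm \<sigma>) = (\<sigma> w < \<gamma>1)"
| "proper w (Conf m l \<sigma>) = (- aR < l \<and> l < aA)"
| "proper w (Resume \<sigma>) = (\<sigma> w < \<gamma>2)"
| "proper w (Done m) = True"

lemma proper_comm: "w \<in> {1..M} \<Longrightarrow> proper w (comm \<sigma>)"
  using aA_pos aR_pos by (auto simp: comm_def not_le)

lemma proper_resume: "w \<in> {1..M} \<Longrightarrow> proper w (resume \<sigma>)"
  by (auto simp: resume_def not_le)

lemma proper_step: "w \<in> {1..M} \<Longrightarrow> proper w s \<Longrightarrow> proper w (step s u y)"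
  by (cases s) (auto simp: proper_comm proper_resume)

lemma time_pot_nonneg: "0 \<le> time_pot w s"
  by (cases s) (auto intro!: add_nonneg_nonneg mult_nonneg_nonneg J.G_nonneg A.G_nonneg R.G_nonneg overtake_nonneg)

lemma time_pot_resume: "time_pot w (resume \<sigma>) \<le> J.G (\<gamma>2 - \<sigma> w)"
  using J.G_nonneg by (simp add: resume_def)

lemma time_pot_comm: "time_pot w (comm \<sigma>) \<le> time_pot w (Comm \<sigma>)"
proof (cases "\<exists>m\<in>{1..M}. \<gamma>1 \<le> \<sigma> m")
  case cross: True
  show ?thesis
  proof (cases "winner \<gamma>1 \<sigma> = w")
    case True
    \<comment> \<open>The true message has just reached \<open>\<gamma>1\<close>, so after a false
      rejection at most \<open>\<gamma>2 - \<gamma>1\<close> is left to climb.\<close>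
    have "J.G (\<gamma>2 - \<sigma> w) \<le> J.G (\<gamma>2 - \<gamma>1)"
      by (rule J.G_mono) (use winner[OF cross] True in auto)
    hence "exp (- aR) * J.G (\<gamma>2 - \<sigma> w) \<le> exp (- aR) * J.G (\<gamma>2 - \<gamma>1)" by simp
    moreover have "0 \<le> J.G (\<gamma>1 - \<sigma> w)" by (rule J.G_nonneg)
    moreover have "0 \<le> overtake w \<gamma>1 \<sigma> * (R.G aR + J.G (\<gamma>2 - \<gamma>1))"
      by (intro mult_nonneg_nonneg add_nonneg_nonneg overtake_nonneg R.G_nonneg J.G_nonneg)
    moreover have "time_pot w (comm \<sigma>) = A.G aA + exp (- aR) * J.G (\<gamma>2 - \<sigma> w)"
      using cross True by (simp add: comm_def)
    ultimately show ?thesis unfolding time_pot.simps by linarith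
  next
    case False
    have "J.G (\<gamma>2 - \<sigma> w) \<le> J.G (\<gamma>1 - \<sigma> w) + J.G (\<gamma>2 - \<gamma>1)"
      using J.G_subadditive[of "\<gamma>2 - \<gamma>1" "\<gamma>1 - \<sigma> w"] g12 by simp
    \<comment> \<open>A wrong winner makes \<open>overtake w \<gamma>1 \<sigma>\<close> at least 1,
      which pays for the rejection and for the climb from \<open>\<gamma>1\<close> to
      \<open>\<gamma>2\<close>.\<close>
    moreover have "1 * (R.G aR + J.G (\<gamma>2 - \<gamma>1)) \<le> overtake w \<gamma>1 \<sigma> * (R.G aR + J.G (\<gamma>2 - \<gamma>1))"
      by (intro mult_right_mono add_nonneg_nonneg overtake_ge_1 cross False R.G_nonneg J.G_nonneg)
    moreover have "0 \<le> A.G aA" "0 \<le> exp (- aR) * J.G (\<gamma>2 - \<gamma>1)"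
      by (auto intro!: mult_nonneg_nonneg A.G_nonneg J.G_nonneg)
    ultimately show ?thesis using cross False by (simp add: comm_def)
  qed
qed (simp add: comm_def)

lemma info_step_mean:
  assumes w: "w \<in> {1..M}" and "\<sigma> w < \<gamma>"
  shows "1 + fmean letters (\<lambda>u. fmean (W (u ! (w - 1))) (\<lambda>y. J.G (\<gamma> - update \<sigma> u y w))) = J.G (\<gamma> - \<sigma> w)"
  using true_message_mean[OF w, of "\<lambda>i. J.G (\<gamma> - \<sigma> w - i)"] J.G_eq[of "\<gamma> - \<sigma> w"] assms(2)
  by (simp add: update_def diff_diff_add)

lemma time_pot_step:
  assumes w: "w \<in> {1..M}" and s: "\<not> finished s" and I: "proper w s"
  shows "1 + fmean letters (\<lambda>u. fmean (W (inp w s u)) (\<lambda>y. time_pot w (step s u y))) \<le> time_pot w s"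
proof (cases s)
  case (Comm \<sigma>)
  have "fmean letters (\<lambda>u. fmean (W (inp w s u)) (\<lambda>y. time_pot w (step s u y)))
    \<le> fmean letters (\<lambda>u. fmean (W (u ! (w - 1))) (\<lambda>y. time_pot w (Comm (update \<sigma> u y))))"
    unfolding Comm inp.simps step.simps by (intro fmean_mono time_pot_comm)
  also have "1 + \<dots> = time_pot w s"
    using info_step_mean[OF w, of \<sigma> \<gamma>1] I Comm overtake_mean[OF w, of \<gamma>1 \<sigma>]
    by (simp add: fmean_linear fmean_const finite_letters)
  finally show ?thesis by simp
next
  case (Resume \<sigma>)
  have "fmean letters (\<lambda>u. fmean (W (inp w s u)) (\<lambda>y. time_pot w (step s u y)))
    \<le> fmean letters (\<lambda>u. fmean (W (u ! (w - 1))) (\<lambda>y. J.G (\<gamma>2 - update \<sigma> u y w)))"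
    unfolding Resume inp.simps step.simps by (intro fmean_mono time_pot_resume)
  thus ?thesis using Resume info_step_mean[OF w, of \<sigma> \<gamma>2] I by simp
next
  case (Conf m l \<sigma>)
  let ?g = "J.G (\<gamma>2 - \<sigma> w)"
  have l: "- aR < l" "l < aA" using I Conf by auto
  have "1 + fmean (W (if m = w then xA else xR)) (\<lambda>y. time_pot w (step s u y)) \<le> time_pot w s" for u
  proof (cases "m = w")
    case True
    \<comment> \<open>The martingale \<open>exp (- l)\<close> prices a false rejection: its
      coefficient is at least 1 when the lower threshold is crossed, which covers the cost
      \<open>?g\<close> of resuming.\<close>
    have "fmean (W xA) (\<lambda>y. time_pot w (step s u y))
      \<le> fmean (W xA) (\<lambda>y. A.G (aA - l - llr y) + exp (- llr y) * (exp (- aR - l) * ?g))"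
    proof (rule fmean_mono)
      fix y
      have e: "exp (- llr y) * (exp (- aR - l) * ?g) = exp (- aR - (l + llr y)) * ?g"
        by (simp add: mult.assoc[symmetric] algebra_simps flip: exp_add)
      have "1 * ?g \<le> exp (- aR - (l + llr y)) * ?g" if "l + llr y \<le> - aR"
        by (rule mult_right_mono) (use that J.G_nonneg in auto)
      moreover have "0 \<le> exp (- aR - (l + llr y)) * ?g" using J.G_nonneg by simp
      moreover have "0 \<le> A.G (aA - l - llr y)" by (rule A.G_nonneg)
      ultimately show "time_pot w (step s u y) \<le> A.G (aA - l - llr y) + exp (- llr y) * (exp (- aR - l) * ?g)"
        unfolding e using Conf True time_pot_resume[of w \<sigma>] by (auto simp: algebra_simps)
    qed
    also have "\<dots> = A.G (aA - l) - 1 + exp (- aR - l) * ?g"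
      using A.G_eq[of "aA - l"] l by (simp add: fmean_add fmean_cmult_right exp_neg_llr_mean)
    finally show ?thesis using Conf True by simp
  next
    case False
    \<comment> \<open>Under \<open>xR\<close> the walk \<open>- l\<close> drifts up to
      \<open>aR\<close>; a false acceptance ends the run earlier and only saves time.\<close>
    have "fmean (W xR) (\<lambda>y. time_pot w (step s u y)) \<le> fmean (W xR) (\<lambda>y. R.G (aR + l - llr' y) + ?g)"
    proof (rule fmean_mono)
      fix y
      have "0 \<le> R.G (aR + l - llr' y)" "0 \<le> ?g" by (rule R.G_nonneg J.G_nonneg)+
      thus "time_pot w (step s u y) \<le> R.G (aR + l - llr' y) + ?g"
        using Conf False time_pot_resume[of w \<sigma>] by (auto simp: llr'_eq algebra_simps)
    qed
    also have "\<dots> = R.G (aR + l) - 1 + ?g"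
      using R.G_eq[of "aR + l"] l by (simp add: fmean_add fmean_const)
    finally show ?thesis using Conf False by simp
  qed
  hence "fmean letters (\<lambda>u. fmean (W (if m = w then xA else xR)) (\<lambda>y. time_pot w (step s u y))) \<le> fmean letters (\<lambda>u. time_pot w s - 1)"
    by (intro fmean_mono) (simp add: algebra_simps)
  thus ?thesis using Conf by (simp add: fmean_const finite_letters)
qed (use s in simp)

section \<open>Choice of the horizon and assembly of the bounds\<close>

definition err_bound :: real where
  "err_bound = (real M - 1) * (exp (- (\<gamma>1 + aA)) + exp (- \<gamma>2))"

definition time_bound :: real where
  "time_bound = J.G \<gamma>1 + ((real M - 1) * exp (- \<gamma>1) + exp (- aR)) * J.G (\<gamma>2 - \<gamma>1)
     + A.G aA + (real M - 1) * exp (- \<gamma>1) * R.G aR"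

lemma vlf_code_scheme:
  assumes "0 < T" "0 \<le> q" "q \<le> 1" "0 < N" "(1 - q) * time_bound \<le> N" "0 < \<epsilon>" "\<epsilon> < 1"
    "q * (1 - 1 / real M) + (1 - q) * (err_bound + time_bound / real T) \<le> \<epsilon>"
  shows "vlf_code W N M \<epsilon>"
proof (rule vlf_code_of_automaton[where p = letters and inp = inp and step = step and final = finished
      and ?s0.0 = "Comm (\<lambda>_. 0)" and dec = dec and T = T and q = q and e = err_bound and N' = time_bound])
  fix w assume w: "w \<in> {1..M}"
  have "fmean (replicate_pmf T letters) (coding_automaton.exit_time W finished (inp w) step (Comm (\<lambda>_. 0)))
    \<le> time_pot w (Comm (\<lambda>_. 0))"
    by (rule coding_automaton.exit_time_le_potential[where I = "proper w"])
       (use w g1_pos in \<open>auto simp: proper_step time_pot_nonneg finite_letters intro!: time_pot_step simp del: time_pot.simps\<close>)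
  thus "fmean (replicate_pmf T letters) (coding_automaton.exit_time W finished (inp w) step (Comm (\<lambda>_. 0))) \<le> time_bound"
    by (simp add: time_bound_def overtake_init[OF w] algebra_simps)
  have "of_bool (finished s \<and> dec s \<noteq> w) \<le> err_pot w s" for s
    using w by (cases s) (auto simp: dec_def overtake_nonneg intro!: add_nonneg_nonneg)
  hence "fmean (replicate_pmf T letters) (coding_automaton.exit_cost W finished (inp w) step
      (\<lambda>s. of_bool (finished s \<and> dec s \<noteq> w)) (Comm (\<lambda>_. 0))) \<le> err_pot w (Comm (\<lambda>_. 0))"
    by (intro coding_automaton.exit_cost_le_potential[where I = "\<lambda>_. True"])
       (use w in \<open>auto simp: finite_letters intro!: err_pot_step simp del: err_pot.simps\<close>)
  thus "fmean (replicate_pmf T letters) (coding_automaton.exit_cost W finished (inp w) step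
      (\<lambda>s. of_bool (finished s \<and> dec s \<noteq> w)) (Comm (\<lambda>_. 0))) \<le> err_bound"
    by (simp add: err_bound_def overtake_init[OF w] distrib_left)
qed (use assms M_pos dec_in finite_letters in auto)

lemma time_bound_pos: "0 < time_bound"
proof -
  have "0 < \<gamma>1 / J.C" using g1_pos J.drift_pos by simp
  also have "\<dots> \<le> J.G \<gamma>1" by (rule J.G_ge)
  also have "\<dots> \<le> time_bound" unfolding time_bound_def add.assoc
    using M_pos by (intro add_increasing2 add_nonneg_nonneg mult_nonneg_nonneg J.G_nonneg A.G_nonneg R.G_nonneg) auto
  finally show ?thesis .
qed

text \<open>A code must have error level below 1, so a vacuous \<open>err_bound\<close> is treated
  apart by pure guessing.\<close>

lemma vlf_code_exists:
  assumes \<epsilon>0: "0 < \<epsilon>0" "\<epsilon>0 < 1"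
  shows "\<exists>\<epsilon>. vlf_code W ((1 - \<epsilon>0) * time_bound) M \<epsilon> \<and> \<epsilon> \<le> \<epsilon>0 + (1 - \<epsilon>0) * err_bound"
proof (cases "1 \<le> err_bound")
  case True
  \<comment> \<open>With \<open>q = 1\<close> the error is \<open>1 - 1 / M\<close>; the larger
    level chosen here is positive also for \<open>M = 1\<close>.\<close>
  have code: "vlf_code W ((1 - \<epsilon>0) * time_bound) M (1 - 1 / (2 * real M))"
    by (rule vlf_code_scheme[where T = 1 and q = 1])
       (use M_pos \<epsilon>0 time_bound_pos in \<open>auto simp: field_simps\<close>)
  have "1 - 1 / (2 * real M) \<le> \<epsilon>0 + (1 - \<epsilon>0) * 1" by simp
  also have "\<dots> \<le> \<epsilon>0 + (1 - \<epsilon>0) * err_bound"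
    using True \<epsilon>0 by (intro add_left_mono mult_left_mono) auto
  finally have "1 - 1 / (2 * real M) \<le> \<epsilon>0 + (1 - \<epsilon>0) * err_bound" .
  with code show ?thesis by blast
next
  case False
  \<comment> \<open>Chosen so that the cut-off costs at most \<open>\<epsilon>0 / M\<close>, the
    amount saved by correct guesses at time 0.\<close>
  define T where "T = nat \<lceil>(1 - \<epsilon>0) * time_bound * real M / \<epsilon>0\<rceil>"
  have pos: "0 < (1 - \<epsilon>0) * time_bound * real M / \<epsilon>0" using \<epsilon>0 time_bound_pos M_pos by simp
  have T: "(1 - \<epsilon>0) * time_bound * real M / \<epsilon>0 \<le> real T" unfolding T_def by linarith
  hence T_pos: "0 < T" using pos by (metis not_le of_nat_0 of_nat_0_less_iff order_less_le_trans)
  have "(1 - \<epsilon>0) * (time_bound / real T) \<le> \<epsilon>0 / real M"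
    using T T_pos M_pos \<epsilon>0 by (simp add: field_simps)
  moreover have "0 < \<epsilon>0 + (1 - \<epsilon>0) * err_bound"
    using M_pos \<epsilon>0 by (intro add_pos_nonneg mult_nonneg_nonneg) (auto simp: err_bound_def)
  moreover have "(1 - \<epsilon>0) * err_bound < (1 - \<epsilon>0) * 1" using False \<epsilon>0 by (intro mult_strict_left_mono) auto
  ultimately have "vlf_code W ((1 - \<epsilon>0) * time_bound) M (\<epsilon>0 + (1 - \<epsilon>0) * err_bound)"
    using \<epsilon>0 time_bound_pos T_pos
    by (intro vlf_code_scheme[where T = T and q = \<epsilon>0]) (auto simp: algebra_simps)
  thus ?thesis by blast
qed

lemma time_bound_le:
  "time_bound \<le> (\<gamma>1 + bfun (joint_dist W PX) info) / mutual_info W PX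
     + ((real M - 1) * exp (- \<gamma>1) + exp (- aR)) * ((\<gamma>2 - \<gamma>1 + bfun (joint_dist W PX) info) / mutual_info W PX)
     + (aA + bfun (W xA) llr) / kl_div (W xA) (W xR)
     + (real M - 1) * exp (- \<gamma>1) * ((aR + bfun (W xR) llr') / kl_div (W xR) (W xA))"
proof -
  have eqs: "mutual_info W PX = J.C" "kl_div (W xA) (W xR) = A.C" "kl_div (W xR) (W xA) = R.C"
    by (simp_all add: mutual_info_def fmean_eq_expectation kl_div_fmean llr_def[abs_def] llr'_def[abs_def])
  show ?thesis unfolding time_bound_def eqs
    using M_pos g1_pos g12 aA_pos aR_pos
    by (intro add_mono mult_left_mono J.crossing_time_le A.crossing_time_le R.crossing_time_le) auto
qed

end

theorem theorem1:
  fixes W :: "'x::finite \<Rightarrow> 'y::finite pmf"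
    and M :: nat
    and \<gamma>1 \<gamma>2 aA aR \<epsilon>0 :: real
    and PX :: "'x pmf"
    and xA xR :: 'x
  assumes M_pos: "1 \<le> M"
    and g1_pos: "0 < \<gamma>1" and g12: "\<gamma>1 < \<gamma>2"
    and aA_pos: "0 < aA" and aR_pos: "0 < aR"
    and eps0: "0 < \<epsilon>0" "\<epsilon>0 < 1"
    and cap_ach: "mutual_info W PX = capacity W"
    and argmax: "\<forall>x x'. kl_div (W x) (W x') \<le> kl_div (W xA) (W xR)"
    and finite_div: "\<forall>x x' y. 0 < pmf (W x) y \<longrightarrow> 0 < pmf (W x') y"
    and C_pos: "0 < capacity W"
  shows "let C = capacity W;
             DA = kl_div (W xA) (W xR);
             DR = kl_div (W xR) (W xA);
             b = bfun (joint_dist W PX) (\<lambda>(x, y). info_density W PX x y);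
             bA = bfun (W xA) (\<lambda>y. ln (pmf (W xA) y / pmf (W xR) y));
             bR = bfun (W xR) (\<lambda>y. ln (pmf (W xR) y / pmf (W xA) y));
             \<epsilon>' = (real M - 1) * (exp (- (\<gamma>1 + aA)) + exp (- \<gamma>2));
             N' = (\<gamma>1 + b) / C
                  + ((real M - 1) * exp (- \<gamma>1) + exp (- aR)) * ((\<gamma>2 - \<gamma>1 + b) / C)
                  + (aA + bA) / DA
                  + (real M - 1) * exp (- \<gamma>1) * ((aR + bR) / DR)
         in \<exists>N \<epsilon>. vlf_code W N M \<epsilon> \<and> N \<le> (1 - \<epsilon>0) * N' \<and> \<epsilon> \<le> \<epsilon>0 + (1 - \<epsilon>0) * \<epsilon>'"
proof -
  have pos: "0 < kl_div (W x) (W x')" if "W x \<noteq> W x'" for x x'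
    by (rule kl_div_pos[OF _ that]) (use finite_div in \<open>auto simp: pmf_positive_iff\<close>)
  \<comment> \<open>If the rows of a maximizing pair agreed, all divergences would vanish, all rows
    would agree and the capacity would be 0.\<close>
  have "W xA \<noteq> W xR"
  proof
    assume "W xA = W xR"
    hence "W x = W xA" for x using pos[of x xA] argmax[rule_format, of x xA] by force
    hence "W = (\<lambda>_. W xA)" by blast
    hence "mutual_info W PX = 0" using mutual_info_const[of "W xA" PX] by simp
    thus False using cap_ach C_pos by simp
  qed
  then interpret confirm_scheme W PX M \<gamma>1 \<gamma>2 aA aR xA xR
    using pos[of xA xR] pos[of xR xA] finite_div cap_ach C_pos M_pos g1_pos g12 aA_pos aR_pos
    by unfold_locales auto
  obtain \<epsilon> where \<epsilon>: "vlf_code W ((1 - \<epsilon>0) * time_bound) M \<epsilon>" "\<epsilon> \<le> \<epsilon>0 + (1 - \<epsilon>0) * err_bound"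
    using vlf_code_exists[OF eps0] by blast
  show ?thesis
    unfolding Let_def cap_ach[symmetric] err_bound_def[symmetric]
      llr_def[abs_def, symmetric] llr'_def[abs_def, symmetric]
    using \<epsilon> time_bound_le eps0
    by (intro exI[of _ "(1 - \<epsilon>0) * time_bound"] exI[of _ \<epsilon>] conjI mult_left_mono) auto
qed

end
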